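(* Let $N\ge 1$, $0\le\alpha\le N$ and $n\in\mathbb Z$. The operator $\rho(D_{\alpha;n})$ on $V$ leaves the space $\mathcal S_N\subset V$ of symmetric functions of $x_1,\dots,x_N$ invariant, and its restriction to $\mathcal S_N$ is $$\rho(D_{\alpha;n})\big|_{\mathcal S_N}=\sum_{I\subset[1,N],\,|I|=\alpha}\Big(\prod_{i\in I}x_i\Big)^n\prod_{i\in I,\ j\notin I}\frac{\theta x_i-\theta^{-1}x_j}{x_i-x_j}\ \prod_{i\in I}\Gamma_i=\theta^{-\alpha(N-\alpha)}\,\mathcal M_{\alpha;n},$$ where $\mathcal M_{\alpha;n}$ is the generalized Macdonald operator.
   Context: Let $q,\theta$ be indeterminates, $t=\theta^2$, and $V=\mathbb C(q,\theta)(x_1,\dots,x_N)$; $\mathcal S_N$ is the subspace of elements of $V$ invariant under permutations of $x_1,\dots,x_N$. The shift operator $\Gamma_i$ acts by $x_i\mapsto qx_i$, fixing the other variables. The functional representation $\rho$ of the $A_{N-1}$ double affine Hecke algebra on $V$ is given by the following operators: $\rho(X_i)$ is multiplication by $x_i$; $\rho(s_i)$ exchanges $x_i$ and $x_{i+1}$; $$\rho(T_i)=\frac{\theta x_i-\theta^{-1}x_{i+1}}{x_i-x_{i+1}}\rho(s_i)-x_{i+1}\frac{\theta-\theta^{-1}}{x_i-x_{i+1}}\quad(1\le i\le N-1),\qquad \rho(T_i^{-1})=\rho(T_i)-\theta+\theta^{-1};$$ $\rho(\pi)f(x_1,\dots,x_N)=f(x_2,x_3,\dots,x_N,q^{-1}x_1)$;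 and $$\rho(Y_i)=\rho(T_iT_{i+1}\cdots T_{N-1}\,\pi^{-1}\,T_1^{-1}T_2^{-1}\cdots T_{i-1}^{-1})\quad(1\le i\le N).$$ For $n\in\mathbb Z$ set $Y_{i,n}=(X_1X_2\cdots X_{i-1})^{-n}\,Y_i\,(X_1X_2\cdots X_i)^n$. For fixed $n$ the $Y_{i,n}$, $1\le i\le N$, commute with one another. Define $$D_{\alpha;n}=q^{-\alpha n}\sum_{1\le i_1<\cdots<i_\alpha\le N}Y_{i_1,n}Y_{i_2,n}\cdots Y_{i_\alpha,n}.$$ The generalized Macdonald operators are $$\mathcal M_{\alpha;n}=\sum_{I\subset[1,N],\,|I|=\alpha}\ \prod_{i\in I}x_i^n\prod_{i\in I,\ j\notin I}\frac{tx_i-x_j}{x_i-x_j}\prod_{i\in I}\Gamma_i .$$ *)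

theory Defs
  imports
    "HOL.Complex"
    "HOL-Library.Poly_Mapping"
    "HOL-Computational_Algebra.Polynomial"
    "HOL-Computational_Algebra.Fraction_Field"
    "HOL-Combinatorics.Permutations"
begin

text \<open>
  The base field is the field of fractions of \<open>\<complex>[q][\<theta>]\<close>. Polynomials over it are finitely
  supported functions from monomials (themselves finitely supported exponent functions) to
  coefficients. The variables are indexed by all natural numbers, so that a single type serves
  every \<open>N\<close>; the field of rational functions in \<open>x\<^sub>1, \<dots>, x\<^sub>N\<close> is the subset \<open>V N\<close> below.
\<close>

type_synonym base = "complex poly poly fract"
type_synonym mpol = "(nat \<Rightarrow>\<^sub>0 nat) \<Rightarrow>\<^sub>0 base"
type_synonym ratfun = "mpol fract"

definition const :: "base \<Rightarrow> ratfun" where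
  "const c = Fract (Poly_Mapping.single 0 c) 1"

lemma const_0: "const 0 = 0"
  by (simp add: const_def fract_collapse)

lemma const_add: "const (a + b) = const a + const b"
  by (simp add: const_def single_add)

lemma const_mult: "const (a * b) = const a * const b"
  by (simp add: const_def mult_single)

definition q :: ratfun where
  "q = const (Fract [:[:0, 1:]:] 1)"

definition theta :: ratfun where
  "theta = const (Fract [:0, 1:] 1)"

definition t :: ratfun where
  "t = theta ^ 2"

definition x :: "nat \<Rightarrow> ratfun" where
  "x i = Fract (Poly_Mapping.single (Poly_Mapping.single i 1) 1) 1"

definition vars :: "mpol \<Rightarrow> nat set" where
  "vars p = (\<Union>m\<in>Poly_Mapping.keys p. Poly_Mapping.keys m)"

definition V :: "nat \<Rightarrow> ratfun set" where
  "V N = {Fract a b |a b. b \<noteq> 0 \<and> vars a \<subseteq> {1..N} \<and> vars b \<subseteq> {1..N}}"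

definition subst_mpol :: "(nat \<Rightarrow> ratfun) \<Rightarrow> mpol \<Rightarrow> ratfun" where
  "subst_mpol \<sigma> p = (\<Sum>m\<in>Poly_Mapping.keys p.
     const (Poly_Mapping.lookup p m) * (\<Prod>i\<in>Poly_Mapping.keys m. \<sigma> i ^ Poly_Mapping.lookup m i))"

text \<open>
  \<open>subst \<sigma> f\<close> is \<open>f(\<sigma>\<^sub>1, \<sigma>\<^sub>2, \<dots>)\<close>. It is meaningful if \<open>f\<close> has a representation as a fraction whose
  denominator does not vanish under the substitution; the value is then independent of the
  representation (lemma \<open>subst_Fract\<close>).
\<close>
definition subst :: "(nat \<Rightarrow> ratfun) \<Rightarrow> ratfun \<Rightarrow> ratfun" where
  "subst \<sigma> f = (THE g. \<exists>a b. b \<noteq> 0 \<and> f = Fract a b \<and> subst_mpol \<sigma> b \<noteq> 0 \<and>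
                              g = subst_mpol \<sigma> a / subst_mpol \<sigma> b)"

lemma subst_mpol_superset:
  assumes "finite A" "Poly_Mapping.keys p \<subseteq> A"
  shows "subst_mpol \<sigma> p = (\<Sum>m\<in>A.
    const (Poly_Mapping.lookup p m) * (\<Prod>i\<in>Poly_Mapping.keys m. \<sigma> i ^ Poly_Mapping.lookup m i))"
  unfolding subst_mpol_def using assms
  by (intro sum.mono_neutral_left) (auto simp: in_keys_iff const_0)

lemma subst_mpol_add: "subst_mpol \<sigma> (a + b) = subst_mpol \<sigma> a + subst_mpol \<sigma> b"
  using Poly_Mapping.keys_add[of a b]
  by (subst (1 2 3) subst_mpol_superset[where A = "Poly_Mapping.keys a \<union> Poly_Mapping.keys b"])
     (auto simp: lookup_add const_add sum.distrib ring_distribs)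

lemma subst_mpol_0: "subst_mpol \<sigma> 0 = 0"
  by (simp add: subst_mpol_def)

lemma subst_mpol_sum: "subst_mpol \<sigma> (sum f A) = (\<Sum>i\<in>A. subst_mpol \<sigma> (f i))"
  by (induction A rule: infinite_finite_induct) (auto simp: subst_mpol_0 subst_mpol_add)

lemma subst_mpol_single: "subst_mpol \<sigma> (Poly_Mapping.single m c) =
    const c * (\<Prod>i\<in>Poly_Mapping.keys m. \<sigma> i ^ Poly_Mapping.lookup m i)"
  by (subst subst_mpol_superset[where A = "{m}"]) auto

lemma prod_keys_add:
  fixes m k :: "nat \<Rightarrow>\<^sub>0 nat"
  shows "(\<Prod>i\<in>Poly_Mapping.keys (m + k). \<sigma> i ^ Poly_Mapping.lookup (m + k) i :: ratfun) =
    (\<Prod>i\<in>Poly_Mapping.keys m. \<sigma> i ^ Poly_Mapping.lookup m i) *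
    (\<Prod>i\<in>Poly_Mapping.keys k. \<sigma> i ^ Poly_Mapping.lookup k i)"
proof -
  have *: "(\<Prod>i\<in>Poly_Mapping.keys l. \<sigma> i ^ Poly_Mapping.lookup l i) =
      (\<Prod>i\<in>A. \<sigma> i ^ Poly_Mapping.lookup l i)"
    if "finite A" "Poly_Mapping.keys l \<subseteq> A" for A and l :: "nat \<Rightarrow>\<^sub>0 nat"
    using that by (intro prod.mono_neutral_left) (auto simp: in_keys_iff)
  show ?thesis
    using Poly_Mapping.keys_add[of m k]
    by (subst (1 2 3) *[where A = "Poly_Mapping.keys m \<union> Poly_Mapping.keys k"])
       (auto simp: lookup_add power_add prod.distrib)
qed

lemma mpol_eq_sum: "(p :: mpol) =
    (\<Sum>m\<in>Poly_Mapping.keys p. Poly_Mapping.single m (Poly_Mapping.lookup p m))"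
  by (rule poly_mapping_eqI) (auto simp: lookup_sum lookup_single when_def in_keys_iff)

lemma subst_mpol_mult: "subst_mpol \<sigma> (a * b) = subst_mpol \<sigma> a * subst_mpol \<sigma> b"
proof -
  have "a * b = (\<Sum>m\<in>Poly_Mapping.keys a. \<Sum>k\<in>Poly_Mapping.keys b.
      Poly_Mapping.single m (Poly_Mapping.lookup a m) * Poly_Mapping.single k (Poly_Mapping.lookup b k))"
    by (subst (1) mpol_eq_sum[of a], subst (1) mpol_eq_sum[of b]) (simp only: sum_product)
  then show ?thesis
    by (simp add: subst_mpol_sum mult_single subst_mpol_single prod_keys_add const_mult)
       (simp add: subst_mpol_def sum_product mult_ac)
qed

lemma subst_Fract:
  assumes "subst_mpol \<sigma> b \<noteq> 0"
  shows "subst \<sigma> (Fract a b) = subst_mpol \<sigma> a / subst_mpol \<sigma> b"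
proof -
  have b: "b \<noteq> 0"
    using assms by (auto simp: subst_mpol_0)
  show ?thesis
    unfolding subst_def
  proof (rule the_equality)
    fix g assume "\<exists>c d. d \<noteq> 0 \<and> Fract a b = Fract c d \<and> subst_mpol \<sigma> d \<noteq> 0 \<and>
      g = subst_mpol \<sigma> c / subst_mpol \<sigma> d"
    then obtain c d where cd: "d \<noteq> 0" "Fract a b = Fract c d" "subst_mpol \<sigma> d \<noteq> 0"
      "g = subst_mpol \<sigma> c / subst_mpol \<sigma> d" by blast
    have "a * d = c * b"
      using cd b by (simp add: eq_fract)
    then have "subst_mpol \<sigma> a * subst_mpol \<sigma> d = subst_mpol \<sigma> c * subst_mpol \<sigma> b"
      by (metis subst_mpol_mult)
    then show "g = subst_mpol \<sigma> a / subst_mpol \<sigma> b"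
      unfolding cd(4) using cd(3) assms by (simp add: frac_eq_eq)
  qed (use assms b in auto)
qed

definition Sym :: "nat \<Rightarrow> ratfun set" where
  "Sym N = {f \<in> V N. \<forall>p. p permutes {1..N} \<longrightarrow> subst (\<lambda>i. x (p i)) f = f}"

definition Gamma :: "nat \<Rightarrow> ratfun \<Rightarrow> ratfun" where
  "Gamma i = subst (x(i := q * x i))"

definition comp_list :: "('a \<Rightarrow> 'a) list \<Rightarrow> 'a \<Rightarrow> 'a" where
  "comp_list fs = foldr (\<circ>) fs id"

text \<open>The operators \<open>Gamma i\<close> commute, so the order of composition is immaterial.\<close>
definition Gamma_set :: "nat set \<Rightarrow> ratfun \<Rightarrow> ratfun" where
  "Gamma_set I = comp_list (map Gamma (sorted_list_of_set I))"

text \<open>The functional representation of the double affine Hecke algebra; products in the algebra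
  are represented by compositions of operators.\<close>

definition rho_s :: "nat \<Rightarrow> ratfun \<Rightarrow> ratfun" where
  "rho_s i = subst (x(i := x (i + 1), i + 1 := x i))"

definition rho_T :: "nat \<Rightarrow> ratfun \<Rightarrow> ratfun" where
  "rho_T i f = (theta * x i - inverse theta * x (i + 1)) / (x i - x (i + 1)) * rho_s i f
             - x (i + 1) * ((theta - inverse theta) / (x i - x (i + 1))) * f"

definition rho_T_inv :: "nat \<Rightarrow> ratfun \<Rightarrow> ratfun" where
  "rho_T_inv i f = rho_T i f - theta * f + inverse theta * f"

definition rho_pi :: "nat \<Rightarrow> ratfun \<Rightarrow> ratfun" where
  "rho_pi N = subst (\<lambda>i. if i = N then inverse q * x 1 else if i \<in> {1..<N} then x (i + 1) else x i)"

definition rho_pi_inv :: "nat \<Rightarrow> ratfun \<Rightarrow> ratfun" where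
  "rho_pi_inv N = inv_into (V N) (rho_pi N)"

definition rho_Y :: "nat \<Rightarrow> nat \<Rightarrow> ratfun \<Rightarrow> ratfun" where
  "rho_Y N i = comp_list (map rho_T [i..<N]) \<circ> rho_pi_inv N \<circ> comp_list (map rho_T_inv [1..<i])"

text \<open>\<open>rho_X_powi k n\<close> represents \<open>(X\<^sub>1 \<cdots> X\<^sub>k)\<^sup>n\<close> for an integer \<open>n\<close>: \<open>X\<^sub>i\<close> is represented by
  multiplication by \<open>x\<^sub>i\<close>, so \<open>X\<^sub>1 \<cdots> X\<^sub>k\<close> is multiplication by \<open>x\<^sub>1 \<cdots> x\<^sub>k\<close> and its
  inverse is multiplication by the inverse.\<close>
definition rho_X_powi :: "nat \<Rightarrow> int \<Rightarrow> ratfun \<Rightarrow> ratfun" where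
  "rho_X_powi k n f = (\<Prod>j=1..k. x j) powi n * f"

definition rho_Yn :: "nat \<Rightarrow> int \<Rightarrow> nat \<Rightarrow> ratfun \<Rightarrow> ratfun" where
  "rho_Yn N n i = rho_X_powi (i - 1) (- n) \<circ> rho_Y N i \<circ> rho_X_powi i n"

definition rho_D :: "nat \<Rightarrow> nat \<Rightarrow> int \<Rightarrow> ratfun \<Rightarrow> ratfun" where
  "rho_D N \<alpha> n f = q powi (- (int \<alpha> * n)) *
     (\<Sum>I | I \<subseteq> {1..N} \<and> card I = \<alpha>. comp_list (map (rho_Yn N n) (sorted_list_of_set I)) f)"

definition gen_Macdonald :: "nat \<Rightarrow> nat \<Rightarrow> int \<Rightarrow> ratfun \<Rightarrow> ratfun" where
  "gen_Macdonald N \<alpha> n f = (\<Sum>I | I \<subseteq> {1..N} \<and> card I = \<alpha>.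
     (\<Prod>i\<in>I. x i powi n) * (\<Prod>i\<in>I. \<Prod>j\<in>{1..N} - I. (t * x i - x j) / (x i - x j)) * Gamma_set I f)"

end

theory Submission
  imports Defs
begin

text \<open>
  Write \<open>G\<^sub>K = (\<Prod>i\<in>K. x\<^sub>i)\<^sup>n \<Gamma>\<^sub>K f\<close> for symmetric \<open>f\<close>, and let \<open>\<Phi>(S, m, R)\<close> be the sum over the
  \<open>m\<close>-element subsets \<open>L\<close> of \<open>S\<close> of
  \<open>\<Prod>i\<in>L. \<Prod>j\<in>S-L. (\<theta> x\<^sub>i - \<theta>\<^sup>-\<^sup>1 x\<^sub>j) / (x\<^sub>i - x\<^sub>j)\<close> times \<open>G\<^bsub>L\<union>R\<^esub>\<close>. By descending induction on \<open>k\<close>,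
  the sum of the ordered products of \<open>Y\<^bsub>i,n\<^esub>\<close> over the \<open>m\<close>-element subsets of \<open>[k, N]\<close>, applied
  to \<open>f\<close>, is \<open>q\<^bsup>mn\<^esup> \<theta>\<^bsup>-m(k-1)\<^esup> \<Phi>([k, N], m, \<emptyset>)\<close>. In the induction step \<open>Y\<^bsub>k,n\<^esub>\<close> acts on a function
  that is symmetric in \<open>x\<^sub>1, \<dots>, x\<^sub>k\<close>, where it equals
  \<open>q\<^sup>n \<theta>\<^bsup>-(k-1)\<^esup> T\<^sub>k \<dots> T\<^bsub>N-1\<^esub> x\<^sub>N\<^sup>n \<pi>\<^sup>-\<^sup>1\<close>; the last two factors turn
  \<open>\<Phi>([k+1, N], m-1, \<emptyset>)\<close> into \<open>\<Phi>([k, N-1], m-1, {N})\<close>. On functions symmetric in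
  \<open>x\<^sub>k, \<dots>, x\<^bsub>N-1\<^esub>\<close> the product \<open>T\<^sub>k \<dots> T\<^bsub>N-1\<^esub>\<close> is an explicit combination of the
  transpositions of \<open>j\<close> and \<open>N\<close>, and comparing coefficients of \<open>G\<^sub>K\<close> leaves partial fraction
  identities.
\<close>

section \<open>Substitution as a field homomorphism\<close>

definition emb :: "mpol \<Rightarrow> ratfun" where
  "emb p = Fract p 1"

lemma emb_0 [simp]: "emb 0 = 0" and emb_1 [simp]: "emb 1 = 1"
  and emb_add: "emb (a + b) = emb a + emb b" and emb_mult: "emb (a * b) = emb a * emb b"
  by (simp_all add: emb_def fract_collapse)

lemma emb_power: "emb (a ^ k) = emb a ^ k"
  by (induction k) (simp_all add: emb_mult)

lemma emb_sum: "emb (sum f A) = (\<Sum>i\<in>A. emb (f i))"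
  by (induction A rule: infinite_finite_induct) (simp_all add: emb_add)

lemma emb_prod: "emb (prod f A) = (\<Prod>i\<in>A. emb (f i))"
  by (induction A rule: infinite_finite_induct) (simp_all add: emb_mult)

lemma emb_eq_iff [simp]: "emb a = emb b \<longleftrightarrow> a = b"
  by (simp add: emb_def eq_fract)

lemma Fract_eq_emb: "b \<noteq> 0 \<Longrightarrow> Fract a b = emb a / emb b"
  by (simp add: emb_def divide_fract)

lemma const_emb: "const c = emb (Poly_Mapping.single 0 c)"
  by (simp add: const_def emb_def)

lemma x_emb: "x i = emb (Poly_Mapping.single (Poly_Mapping.single i 1) 1)"
  by (simp add: x_def emb_def)

lemma const_1 [simp]: "const 1 = 1"
  by (simp add: const_emb)

lemma const_eq_iff [simp]: "const c = const d \<longleftrightarrow> c = d"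
  by (auto simp: const_emb dest: arg_cong[where f = "\<lambda>p. Poly_Mapping.lookup p 0"])

lemma const_eq_0_iff [simp]: "const c = 0 \<longleftrightarrow> c = 0"
  using const_eq_iff[of c 0] by (simp del: const_eq_iff add: const_0)

lemma const_inverse: "const (inverse c) = inverse (const c)"
proof (cases "c = 0")
  case False
  have "const (inverse c) * const c = 1"
    using False by (simp flip: const_mult)
  then show ?thesis
    by (metis inverse_unique mult.commute)
qed (simp add: const_0)

lemma x_neq_0 [simp]: "x i \<noteq> 0"
proof -
  have "Poly_Mapping.single (Poly_Mapping.single i 1) (1 :: base) \<noteq> 0"
    by (metis lookup_single_eq lookup_zero zero_neq_one)
  then show ?thesis
    using emb_eq_iff[of "Poly_Mapping.single (Poly_Mapping.single i 1) 1" 0]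
    by (simp del: emb_eq_iff One_nat_def add: x_emb)
qed

text \<open>The two sides are monomials with different exponents, so the coefficient at the monomial
  of \<open>x j\<close> tells them apart. The case \<open>c = 1\<close> separates the variables; the
  case of the square of \<open>theta\<close> serves the second partial fraction identity.\<close>

lemma const_mult_x_neq_x:
  assumes "i \<noteq> j"
  shows "const c * x i \<noteq> x j"
proof
  have ne: "Poly_Mapping.single i (1::nat) \<noteq> Poly_Mapping.single j 1"
    using assms by (metis keys_single zero_neq_one singleton_inject)
  assume "const c * x i = x j"
  then have "Poly_Mapping.single (Poly_Mapping.single i 1) c =
      (Poly_Mapping.single (Poly_Mapping.single j 1) 1 :: mpol)"
    by (simp del: One_nat_def add: const_emb x_emb mult_single flip: emb_mult)
  then have "Poly_Mapping.lookup (Poly_Mapping.single (Poly_Mapping.single i 1) c :: mpol) (Poly_Mapping.single j 1) = 1"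
    by (simp del: One_nat_def)
  then show False
    using ne by (simp add: lookup_single)
qed

lemma x_eq_iff [simp]: "x i = x j \<longleftrightarrow> i = j"
  using const_mult_x_neq_x[of i j 1] by auto

lemma single_power:
  "Poly_Mapping.single (Poly_Mapping.single i 1) (1 :: base) ^ k = Poly_Mapping.single (Poly_Mapping.single i k) 1"
  by (induction k) (simp_all add: mult_single flip: single_add)

lemma prod_single:
  "(\<Prod>i\<in>A. Poly_Mapping.single (f i) (1 :: base)) = Poly_Mapping.single (\<Sum>i\<in>A. f i :: nat \<Rightarrow>\<^sub>0 nat) 1"
  by (induction A rule: infinite_finite_induct) (simp_all add: mult_single)

lemma monom_eq_sum: "(m :: nat \<Rightarrow>\<^sub>0 nat) =
    (\<Sum>i\<in>Poly_Mapping.keys m. Poly_Mapping.single i (Poly_Mapping.lookup m i))"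
  by (rule poly_mapping_eqI) (auto simp: lookup_sum lookup_single when_def in_keys_iff)

lemma subst_mpol_x: "subst_mpol x p = emb p"
proof -
  have *: "(\<Prod>i\<in>Poly_Mapping.keys m. x i ^ Poly_Mapping.lookup m i) = emb (Poly_Mapping.single m 1)" for m
  proof -
    have "(\<Prod>i\<in>Poly_Mapping.keys m. x i ^ Poly_Mapping.lookup m i) =
        emb (\<Prod>i\<in>Poly_Mapping.keys m. Poly_Mapping.single (Poly_Mapping.single i (Poly_Mapping.lookup m i)) 1)"
      by (simp only: x_emb emb_prod single_power flip: emb_power)
    then show ?thesis
      by (simp only: prod_single flip: monom_eq_sum)
  qed
  show ?thesis
    by (subst (2) mpol_eq_sum) (simp add: subst_mpol_def * const_emb emb_sum mult_single flip: emb_mult)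
qed

lemma subst_mpol_const: "subst_mpol \<sigma> (Poly_Mapping.single 0 c) = const c"
  by (simp add: subst_mpol_single)

lemma subst_mpol_var: "subst_mpol \<sigma> (Poly_Mapping.single (Poly_Mapping.single i 1) 1) = \<sigma> i"
  by (simp add: subst_mpol_single)

lemma subst_mpol_1: "subst_mpol \<sigma> 1 = 1"
  using subst_mpol_const[of \<sigma> 1] by simp

lemma subst_mpol_power: "subst_mpol \<sigma> (p ^ k) = subst_mpol \<sigma> p ^ k"
  by (induction k) (simp_all add: subst_mpol_1 subst_mpol_mult)

lemma subst_mpol_prod: "subst_mpol \<sigma> (prod f A) = (\<Prod>i\<in>A. subst_mpol \<sigma> (f i))"
  by (induction A rule: infinite_finite_induct) (simp_all add: subst_mpol_1 subst_mpol_mult)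

text \<open>Injectivity on polynomials. No denominator can then vanish, so
  \<open>subst \<sigma>\<close> is defined on all of \<open>ratfun\<close> and is a field
  endomorphism.\<close>

definition admissible :: "(nat \<Rightarrow> ratfun) \<Rightarrow> bool" where
  "admissible \<sigma> \<longleftrightarrow> (\<forall>p. p \<noteq> 0 \<longrightarrow> subst_mpol \<sigma> p \<noteq> 0)"

text \<open>Such a substitution is undone by relabelling with \<open>inv p\<close> and dividing by
  the scalars, so nothing nonzero is sent to zero. Permutations of variables,
  \<open>q\<close>-shifts and \<open>rho_pi\<close> are all of this shape.\<close>

lemma admissible_monomial:
  assumes "bij p" and c: "\<And>i. c i \<noteq> 0"
  shows "admissible (\<lambda>i. const (c i) * x (p i))"
  unfolding admissible_def
proof (intro allI impI)
  fix f :: mpol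
  assume "f \<noteq> 0"
  let ?\<sigma> = "\<lambda>i. const (c i) * x (p i)"
  define s :: "nat \<Rightarrow> mpol" where "s i = Poly_Mapping.single 0 (c i) * Poly_Mapping.single (Poly_Mapping.single (p i) 1) 1" for i
  define \<tau> where "\<tau> j = const (inverse (c (inv p j))) * x (inv p j)" for j
  \<comment> \<open>The value of the substitution is again a polynomial, and \<open>r\<close> is
    that polynomial. \<open>subst_mpol \<tau>\<close> can be applied to it, which returns
    \<open>emb f\<close>.\<close>
  define r where "r = (\<Sum>m\<in>Poly_Mapping.keys f. Poly_Mapping.single 0 (Poly_Mapping.lookup f m) *
      (\<Prod>i\<in>Poly_Mapping.keys m. s i ^ Poly_Mapping.lookup m i))"
  have "emb (s i) = ?\<sigma> i" for i
    by (simp add: s_def const_emb x_emb emb_mult)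
  then have r: "subst_mpol ?\<sigma> f = emb r"
    by (simp add: r_def subst_mpol_def emb_sum emb_mult emb_prod emb_power flip: const_emb)
  have inv: "inv p (p i) = i" for i
    using assms(1) by (simp add: bij_is_inj)
  have "subst_mpol \<tau> (s i) = x i" for i
    using c[of i] by (simp add: s_def subst_mpol_mult subst_mpol_const subst_mpol_var[simplified] \<tau>_def inv
      const_inverse)
  then have "subst_mpol \<tau> r = subst_mpol x f"
    by (simp add: r_def subst_mpol_sum subst_mpol_mult subst_mpol_prod subst_mpol_power subst_mpol_const)
       (simp add: subst_mpol_def)
  then have "r \<noteq> 0"
    using \<open>f \<noteq> 0\<close> emb_eq_iff[of f 0] by (auto simp: subst_mpol_x subst_mpol_0)
  then show "subst_mpol ?\<sigma> f \<noteq> 0"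
    using emb_eq_iff[of r 0] r by simp
qed

context
  fixes \<sigma> :: "nat \<Rightarrow> ratfun"
  assumes \<sigma>: "admissible \<sigma>"
begin

lemma subst_Fract': "b \<noteq> 0 \<Longrightarrow> subst \<sigma> (Fract a b) = subst_mpol \<sigma> a / subst_mpol \<sigma> b"
  using \<sigma> by (simp add: subst_Fract admissible_def)

lemma subst_emb: "subst \<sigma> (emb p) = subst_mpol \<sigma> p"
  by (simp add: emb_def subst_Fract' subst_mpol_1)

lemma subst_const: "subst \<sigma> (const c) = const c"
  by (simp add: const_emb[of c] subst_emb) (simp add: subst_mpol_const const_emb)

lemma subst_x: "subst \<sigma> (x i) = \<sigma> i"
  by (simp add: x_emb subst_emb subst_mpol_var[simplified])

lemma subst_0: "subst \<sigma> 0 = 0" and subst_1: "subst \<sigma> 1 = 1"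
  using subst_const[of 0] subst_const[of 1] by (simp_all add: const_0)

lemma subst_add: "subst \<sigma> (f + g) = subst \<sigma> f + subst \<sigma> g"
proof -
  obtain a b c d where fg: "f = Fract a b" "g = Fract c d" "b \<noteq> 0" "d \<noteq> 0"
    by (metis Fract_cases)
  then have "subst_mpol \<sigma> b \<noteq> 0" "subst_mpol \<sigma> d \<noteq> 0"
    using \<sigma> by (auto simp: admissible_def)
  with fg show ?thesis
    by (simp add: subst_Fract' subst_mpol_add subst_mpol_mult field_simps)
qed

lemma subst_mult: "subst \<sigma> (f * g) = subst \<sigma> f * subst \<sigma> g"
proof -
  obtain a b c d where fg: "f = Fract a b" "g = Fract c d" "b \<noteq> 0" "d \<noteq> 0"
    by (metis Fract_cases)
  then show ?thesis
    by (simp add: subst_Fract' subst_mpol_mult)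
qed

lemma subst_uminus: "subst \<sigma> (- f) = - subst \<sigma> f"
  by (metis add.right_inverse minus_unique subst_add subst_0)

lemma subst_diff: "subst \<sigma> (f - g) = subst \<sigma> f - subst \<sigma> g"
  using subst_add[of f "- g"] by (simp add: subst_uminus)

lemma subst_eq_0_iff: "subst \<sigma> f = 0 \<longleftrightarrow> f = 0"
proof
  assume "subst \<sigma> f = 0"
  then show "f = 0"
    using subst_mult[of f "inverse f"] subst_1 by (cases "f = 0") auto
qed (simp add: subst_0)

lemma subst_inject: "subst \<sigma> f = subst \<sigma> g \<longleftrightarrow> f = g"
  using subst_eq_0_iff[of "f - g"] by (simp add: subst_diff)

lemma subst_inverse: "subst \<sigma> (inverse f) = inverse (subst \<sigma> f)"
proof (cases "f = 0")
  case False
  then show ?thesis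
    using subst_mult[of f "inverse f"] subst_1 by (simp add: inverse_unique)
qed (simp add: subst_0)

lemma subst_divide: "subst \<sigma> (f / g) = subst \<sigma> f / subst \<sigma> g"
  by (simp add: divide_inverse subst_mult subst_inverse)

lemma subst_power: "subst \<sigma> (f ^ k) = subst \<sigma> f ^ k"
  by (induction k) (simp_all add: subst_1 subst_mult)

lemma subst_powi: "subst \<sigma> (f powi k) = subst \<sigma> f powi k"
  by (simp add: power_int_def subst_power subst_inverse)

lemma subst_sum: "subst \<sigma> (sum h A) = (\<Sum>i\<in>A. subst \<sigma> (h i))"
  by (induction A rule: infinite_finite_induct) (simp_all add: subst_0 subst_add)

lemma subst_prod: "subst \<sigma> (prod h A) = (\<Prod>i\<in>A. subst \<sigma> (h i))"
  by (induction A rule: infinite_finite_induct) (simp_all add: subst_1 subst_mult)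

lemma subst_q: "subst \<sigma> q = q" and subst_theta: "subst \<sigma> theta = theta"
  by (simp_all add: q_def theta_def subst_const)

lemma subst_subst_mpol: "subst \<sigma> (subst_mpol \<tau> p) = subst_mpol (\<lambda>i. subst \<sigma> (\<tau> i)) p"
  by (simp add: subst_mpol_def subst_sum subst_mult subst_const subst_prod subst_power)

text \<open>The denominator of the composite is the image under \<open>subst \<sigma>\<close> of the
  nonzero element \<open>subst_mpol \<tau> b\<close>, and it is nonzero because field homomorphisms
  are injective.\<close>

lemma subst_subst:
  assumes \<tau>: "admissible \<tau>"
  shows "subst \<sigma> (subst \<tau> f) = subst (\<lambda>i. subst \<sigma> (\<tau> i)) f"
proof -
  obtain a b where f: "f = Fract a b" "b \<noteq> 0"
    by (metis Fract_cases)
  then have b: "subst_mpol \<tau> b \<noteq> 0"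
    using \<tau> by (simp add: admissible_def)
  have "subst \<sigma> (subst \<tau> f) = subst_mpol (\<lambda>i. subst \<sigma> (\<tau> i)) a / subst_mpol (\<lambda>i. subst \<sigma> (\<tau> i)) b"
    using f b \<tau> by (simp add: subst_Fract subst_divide subst_subst_mpol)
  also have "\<dots> = subst (\<lambda>i. subst \<sigma> (\<tau> i)) f"
    using b f(1) subst_eq_0_iff[of "subst_mpol \<tau> b"]
    by (simp add: subst_Fract subst_subst_mpol)
  finally show ?thesis .
qed

end

lemma subst_id: "subst x f = f"
proof -
  obtain a b where f: "f = Fract a b" "b \<noteq> 0"
    by (metis Fract_cases)
  then show ?thesis
    using emb_eq_iff[of b 0] subst_Fract[of x b a] by (simp add: subst_mpol_x Fract_eq_emb)
qed

section \<open>The subfield \<open>V N\<close> and its stability under substitution\<close>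

lemma vars_add: "vars (a + b) \<subseteq> vars a \<union> vars b"
  using Poly_Mapping.keys_add[of a b] unfolding vars_def by blast

lemma vars_mult: "vars (a * b) \<subseteq> vars a \<union> vars b"
proof
  fix i
  assume "i \<in> vars (a * b)"
  then obtain m where m: "m \<in> Poly_Mapping.keys (a * b)" "i \<in> Poly_Mapping.keys m"
    by (auto simp: vars_def)
  then obtain k l where "m = k + l" "k \<in> Poly_Mapping.keys a" "l \<in> Poly_Mapping.keys b"
    using Poly_Mapping.keys_mult[of a b] by blast
  then show "i \<in> vars a \<union> vars b"
    using m(2) Poly_Mapping.keys_add[of k l] unfolding vars_def by blast
qed

context
  fixes N :: nat
begin

lemma V_Fract: "b \<noteq> 0 \<Longrightarrow> vars a \<subseteq> {1..N} \<Longrightarrow> vars b \<subseteq> {1..N} \<Longrightarrow> Fract a b \<in> V N"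
  unfolding V_def by blast

lemma V_const: "const c \<in> V N"
  unfolding const_def by (rule V_Fract) (auto simp: vars_def split: if_splits)

lemma V_x: "i \<in> {1..N} \<Longrightarrow> x i \<in> V N"
  unfolding x_def by (rule V_Fract) (auto simp: vars_def split: if_splits)

lemma V_0: "0 \<in> V N" and V_1: "1 \<in> V N" and V_q: "q \<in> V N" and V_theta: "theta \<in> V N"
  using V_const[of 0] V_const[of 1] by (simp_all add: const_0 q_def theta_def V_const)

lemma V_mult:
  assumes "f \<in> V N" "g \<in> V N"
  shows "f * g \<in> V N"
proof -
  obtain a b c d where "f = Fract a b" "g = Fract c d" "b \<noteq> 0" "d \<noteq> 0"
    "vars a \<subseteq> {1..N}" "vars b \<subseteq> {1..N}" "vars c \<subseteq> {1..N}" "vars d \<subseteq> {1..N}"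
    using assms unfolding V_def by blast
  then show ?thesis
    using vars_mult[of a c] vars_mult[of b d] by (simp, intro V_Fract) auto
qed

lemma V_add:
  assumes "f \<in> V N" "g \<in> V N"
  shows "f + g \<in> V N"
proof -
  obtain a b c d where "f = Fract a b" "g = Fract c d" "b \<noteq> 0" "d \<noteq> 0"
    "vars a \<subseteq> {1..N}" "vars b \<subseteq> {1..N}" "vars c \<subseteq> {1..N}" "vars d \<subseteq> {1..N}"
    using assms unfolding V_def by blast
  then show ?thesis
    using vars_mult[of a d] vars_mult[of c b] vars_mult[of b d] vars_add[of "a * d" "c * b"]
    by (simp, intro V_Fract) (simp_all, blast+)
qed

lemma V_uminus: "f \<in> V N \<Longrightarrow> - f \<in> V N"
  using V_mult[OF V_const[of "- 1"], of f] const_add[of 1 "- 1"]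
  by (metis add.right_inverse const_0 const_1 minus_unique mult_minus1)

lemma V_diff: "f \<in> V N \<Longrightarrow> g \<in> V N \<Longrightarrow> f - g \<in> V N"
  using V_add[of f "- g"] V_uminus[of g] by simp

lemma V_inverse:
  assumes "f \<in> V N"
  shows "inverse f \<in> V N"
proof (cases "f = 0")
  case False
  obtain a b where f: "f = Fract a b" "b \<noteq> 0" "vars a \<subseteq> {1..N}" "vars b \<subseteq> {1..N}"
    using assms unfolding V_def by blast
  moreover have "a \<noteq> 0"
    using f False by (auto simp: fract_collapse)
  ultimately show ?thesis
    by (simp add: V_Fract)
qed (simp add: V_0)

lemma V_divide: "f \<in> V N \<Longrightarrow> g \<in> V N \<Longrightarrow> f / g \<in> V N"
  by (simp add: divide_inverse V_mult V_inverse)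

lemma V_power: "f \<in> V N \<Longrightarrow> f ^ k \<in> V N"
  by (induction k) (simp_all add: V_1 V_mult)

lemma V_powi: "f \<in> V N \<Longrightarrow> f powi k \<in> V N"
  by (simp add: power_int_def V_power V_inverse)

lemma V_sum: "(\<And>i. i \<in> A \<Longrightarrow> h i \<in> V N) \<Longrightarrow> sum h A \<in> V N"
  by (induction A rule: infinite_finite_induct) (simp_all add: V_0 V_add)

lemma V_prod: "(\<And>i. i \<in> A \<Longrightarrow> h i \<in> V N) \<Longrightarrow> prod h A \<in> V N"
  by (induction A rule: infinite_finite_induct) (simp_all add: V_1 V_mult)

lemma V_subst:
  assumes "admissible \<sigma>" "\<And>i. i \<in> {1..N} \<Longrightarrow> \<sigma> i \<in> V N" "f \<in> V N"
  shows "subst \<sigma> f \<in> V N"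
proof -
  obtain a b where f: "f = Fract a b" "b \<noteq> 0" "vars a \<subseteq> {1..N}" "vars b \<subseteq> {1..N}"
    using assms(3) unfolding V_def by blast
  have "subst_mpol \<sigma> p \<in> V N" if "vars p \<subseteq> {1..N}" for p
    unfolding subst_mpol_def using that assms(2)
    by (intro V_sum V_mult V_prod V_power V_const) (auto simp: vars_def)
  then show ?thesis
    using f assms(1) by (simp add: subst_Fract' V_divide)
qed

end

section \<open>Partial fractions\<close>

text \<open>With \<open>u = theta\<close> this is the coefficient of the transposition in
  \<open>rho_T\<close>. A general field and general arguments are allowed because the partial
  fraction identities also evaluate it at a rescaled point.\<close>

definition hecke_coeff :: "'a::field \<Rightarrow> 'a \<Rightarrow> 'a \<Rightarrow> 'a" where
  "hecke_coeff u v w = (u * v - inverse u * w) / (v - w)"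

lemma hecke_coeff_minus_inverse:
  "v \<noteq> w \<Longrightarrow> hecke_coeff u v w - inverse u = (u - inverse u) * v / (v - w)"
  by (simp add: hecke_coeff_def divide_simps) (simp add: algebra_simps)

text \<open>The coefficients for \<open>(v, w)\<close> and \<open>(w, v)\<close> add up to
  \<open>u + inverse u\<close>.\<close>

lemma hecke_coeff_swap:
  "v \<noteq> w \<Longrightarrow> hecke_coeff u v w - u = inverse u - hecke_coeff u w v"
  by (simp add: hecke_coeff_def divide_simps) (simp add: algebra_simps)

text \<open>Without the constants \<open>inverse u\<close>, each coefficient is a multiple of
  \<open>v / (v - w)\<close>, and both sides become the same product of simple fractions. The
  identity drives both the partial fraction induction and the expansion of a chain of
  \<open>rho_T\<close>.\<close>

lemma hecke_coeff_exchange: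
  fixes v w z u :: "'a::field"
  assumes "v \<noteq> w" "v \<noteq> z" "w \<noteq> z"
  shows "(hecke_coeff u v z - inverse u) * (hecke_coeff u v w - hecke_coeff u z w) =
    (hecke_coeff u w z - inverse u) * (hecke_coeff u v w - inverse u)"
proof -
  define c where "c = u - inverse u"
  have vw: "hecke_coeff u v w = inverse u + c * v / (v - w)"
    using hecke_coeff_minus_inverse[of v w u] assms by (simp add: c_def algebra_simps)
  have zw: "hecke_coeff u z w = inverse u + c * z / (z - w)"
    using hecke_coeff_minus_inverse[of z w u] assms by (simp add: c_def algebra_simps)
  have vz: "hecke_coeff u v z - inverse u = c * v / (v - z)"
    using hecke_coeff_minus_inverse[of v z u] assms by (simp add: c_def)
  have wz: "hecke_coeff u w z - inverse u = c * w / (w - z)"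
    using hecke_coeff_minus_inverse[of w z u] assms by (simp add: c_def)
  have "v - w \<noteq> 0" "z - w \<noteq> 0" "v - z \<noteq> 0" "w - z \<noteq> 0"
    using assms by auto
  then show ?thesis
    unfolding vw zw vz wz by (simp add: divide_simps) (simp add: algebra_simps)
qed

text \<open>Partial fraction expansion of \<open>z \<mapsto> \<Prod>i\<in>K. hecke_coeff u z (y i)\<close>, whose value at infinity is
  \<open>u ^ card K\<close>.\<close>

lemma hecke_partial_fractions:
  fixes y :: "'i \<Rightarrow> 'a::field"
  assumes "finite K" "inj_on y K" "z \<notin> y ` K"
  shows "(\<Prod>i\<in>K. hecke_coeff u z (y i)) +
    (\<Sum>j\<in>K. (hecke_coeff u (y j) z - inverse u) * (\<Prod>i\<in>K - {j}. hecke_coeff u (y j) (y i))) = u ^ card K"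
  using assms
proof (induction K arbitrary: z rule: finite_induct)
  case empty
  then show ?case by simp
next
  case (insert p K)
  let ?h = "hecke_coeff u"
  define Q where "Q j = (\<Prod>i\<in>K - {j}. ?h (y j) (y i))" for j
  define r where "r j w = ?h (y j) w - inverse u" for j w
  have ne: "z \<noteq> y p" "z \<noteq> y j" "y p \<noteq> y j" if "j \<in> K" for j
    using insert.prems insert.hyps that by auto
  \<comment> \<open>The induction hypothesis is used at two points, the old \<open>z\<close> and the
    new node \<open>y p\<close>; hence \<open>z\<close> is kept arbitrary in the induction.\<close>
  have "y p \<notin> y ` K"
    using insert.prems(1) insert.hyps by (auto simp: inj_on_def)
  then have IHp: "(\<Prod>i\<in>K. ?h (y p) (y i)) = u ^ card K - (\<Sum>j\<in>K. r j (y p) * Q j)"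
    using insert.IH[of "y p"] insert.prems by (simp add: Q_def r_def algebra_simps)
  have IHz: "(\<Prod>i\<in>K. ?h z (y i)) = u ^ card K - (\<Sum>j\<in>K. r j z * Q j)"
    using insert.IH[of z] insert.prems by (simp add: Q_def r_def algebra_simps)
  have top: "?h z (y p) + r p z = u"
    using hecke_coeff_swap[of z "y p" u] insert.prems by (simp add: r_def algebra_simps)
  have Qp: "(\<Prod>i\<in>insert p K - {j}. ?h (y j) (y i)) = ?h (y j) (y p) * Q j" if "j \<in> K" for j
  proof -
    have "insert p K - {j} = insert p (K - {j})"
      using that insert.hyps by auto
    then show ?thesis
      using insert.hyps by (simp add: Q_def)
  qed
  \<comment> \<open>This makes the coefficient of each \<open>Q j\<close> vanish once both instances
    of the induction hypothesis are inserted; by \<open>top\<close>, what remains is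
    \<open>u\<close> times \<open>u ^ card K\<close>.\<close>
  have ex: "r j z * (?h (y j) (y p) - ?h z (y p)) = r p z * r j (y p)" if "j \<in> K" for j
    unfolding r_def using ne[OF that] by (intro hecke_coeff_exchange) auto
  have "(\<Prod>i\<in>insert p K. ?h z (y i)) +
      (\<Sum>j\<in>insert p K. r j z * (\<Prod>i\<in>insert p K - {j}. ?h (y j) (y i))) =
      ?h z (y p) * (\<Prod>i\<in>K. ?h z (y i)) + (r p z * (\<Prod>i\<in>K. ?h (y p) (y i)) +
        (\<Sum>j\<in>K. r j z * (?h (y j) (y p) * Q j)))"
    using insert.hyps by (simp add: Qp)
  also have "\<dots> = (?h z (y p) + r p z) * u ^ card K +
      (\<Sum>j\<in>K. (r j z * (?h (y j) (y p) - ?h z (y p)) - r p z * r j (y p)) * Q j)"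
    unfolding IHp IHz
    by (simp add: algebra_simps sum.distrib sum_subtractf sum_distrib_left)
  also have "\<dots> = u ^ card (insert p K)"
    using insert.hyps by (simp add: top ex)
  finally show ?case
    by (simp add: r_def)
qed

text \<open>This is the previous expansion at \<open>z / u\<^sup>2\<close>, because
  \<open>hecke_coeff u (z / u\<^sup>2) v = inverse (hecke_coeff u v z)\<close>.\<close>

lemma hecke_partial_fractions':
  fixes y :: "'i \<Rightarrow> 'a::field"
  assumes "finite K" "inj_on y K" "z \<notin> y ` K" and u: "u \<noteq> 0"
    and ne: "\<And>i. i \<in> K \<Longrightarrow> u ^ 2 * y i \<noteq> z"
  shows "u * (\<Sum>j\<in>K. (hecke_coeff u (y j) z - inverse u) *
      (\<Prod>i\<in>K - {j}. hecke_coeff u (y j) (y i) * hecke_coeff u (y i) z)) =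
    u ^ card K * (\<Prod>i\<in>K. hecke_coeff u (y i) z) - 1"
proof -
  let ?h = "hecke_coeff u"
  define w where "w = z / u ^ 2"
  have z: "z = u ^ 2 * w"
    using u by (simp add: w_def)
  have wy: "w \<noteq> y i" if "i \<in> K" for i
    using ne[OF that] by (auto simp: z)
  then have wK: "w \<notin> y ` K"
    by auto
  have inv: "?h w (y i) * ?h (y i) z = 1" if "i \<in> K" for i
  proof -
    have "y i \<noteq> z"
      using that assms(3) by auto
    then have "w - y i \<noteq> 0" "y i - u ^ 2 * w \<noteq> 0"
      using wy[OF that] by (auto simp: z)
    then show ?thesis
      using u by (simp add: hecke_coeff_def z divide_simps) (simp add: algebra_simps power2_eq_square)
  qed
  \<comment> \<open>The residue factor at \<open>z\<close> is traded for the one at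
    \<open>w\<close>. The extra factor \<open>?h (y j) z\<close> completes the product over
    \<open>K - {j}\<close> to one over \<open>K\<close>, which can then be pulled out of the
    sum.\<close>
  have rz: "u * (?h (y j) z - inverse u) = ?h (y j) z * (?h (y j) w - inverse u)" if "j \<in> K" for j
  proof -
    have "y j \<noteq> z"
      using that assms(3) by auto
    then have "y j - w \<noteq> 0" "y j - u ^ 2 * w \<noteq> 0"
      using wy[OF that] by (auto simp: z)
    then show ?thesis
      using u by (simp add: hecke_coeff_def z divide_simps) (simp add: algebra_simps power2_eq_square)
  qed
  have "u * (\<Sum>j\<in>K. (?h (y j) z - inverse u) * (\<Prod>i\<in>K - {j}. ?h (y j) (y i) * ?h (y i) z)) =
      (\<Sum>j\<in>K. (?h (y j) w - inverse u) * (\<Prod>i\<in>K - {j}. ?h (y j) (y i)) *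
        (?h (y j) z * (\<Prod>i\<in>K - {j}. ?h (y i) z)))"
    unfolding sum_distrib_left mult.assoc[symmetric]
    by (intro sum.cong refl) (simp add: rz prod.distrib mult_ac)
  also have "\<dots> = (\<Sum>j\<in>K. (?h (y j) w - inverse u) * (\<Prod>i\<in>K - {j}. ?h (y j) (y i))) * (\<Prod>i\<in>K. ?h (y i) z)"
    unfolding sum_distrib_right using assms(1) by (intro sum.cong refl) (simp add: prod.remove)
  also have "\<dots> = (u ^ card K - (\<Prod>i\<in>K. ?h w (y i))) * (\<Prod>i\<in>K. ?h (y i) z)"
    by (subst hecke_partial_fractions[OF assms(1,2) wK, of u, symmetric]) simp
  also have "\<dots> = u ^ card K * (\<Prod>i\<in>K. ?h (y i) z) - 1"
    by (simp add: left_diff_distrib inv flip: prod.distrib)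
  finally show ?thesis .
qed

section \<open>Hecke coefficients of the variables and sums over subsets\<close>

abbreviation hecke :: "nat \<Rightarrow> nat \<Rightarrow> ratfun" where
  "hecke i j \<equiv> hecke_coeff theta (x i) (x j)"

definition hecke_prod :: "nat set \<Rightarrow> nat set \<Rightarrow> ratfun" where
  "hecke_prod K M = (\<Prod>i\<in>K. \<Prod>j\<in>M. hecke i j)"

text \<open>For \<open>S = {k..N}\<close> this is the coefficient of the transposition of
  \<open>j\<close> and \<open>N\<close> in the product of \<open>rho_T k\<close>, ...,
  \<open>rho_T (N - 1)\<close>, acting on functions symmetric in the variables from \<open>k\<close>
  to \<open>N - 1\<close>.\<close>

definition chain_coeff :: "nat set \<Rightarrow> nat \<Rightarrow> nat \<Rightarrow> ratfun" where
  "chain_coeff S k j = (if j = k then 1 else hecke j k - inverse theta) * (\<Prod>i\<in>S - {k} - {j}. hecke j i)"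

text \<open>The sum \<Phi>(S, m, R) of the overview. \<open>R\<close> enters the argument of
  \<open>G\<close> but not the coefficients.\<close>

definition subset_sum :: "(nat set \<Rightarrow> ratfun) \<Rightarrow> nat set \<Rightarrow> nat \<Rightarrow> nat set \<Rightarrow> ratfun" where
  "subset_sum G S m R = (\<Sum>L | L \<subseteq> S \<and> card L = m. hecke_prod L (S - L) * G (L \<union> R))"

lemma theta_neq_0 [simp]: "theta \<noteq> 0" and q_neq_0 [simp]: "q \<noteq> 0"
proof -
  have "Fract [:0, 1:] 1 \<noteq> (0 :: base)" "Fract [:[:0, 1:]:] 1 \<noteq> (0 :: base)"
    by (simp_all add: Zero_fract_def eq_fract)
  then show "theta \<noteq> 0" "q \<noteq> 0"
    by (simp_all add: theta_def q_def)
qed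

lemma theta_square_mult_x_neq_x: "i \<noteq> j \<Longrightarrow> theta ^ 2 * x i \<noteq> x j"
  using const_mult_x_neq_x[of i j "Fract [:0, 1:] 1 * Fract [:0, 1:] 1"]
  by (simp add: theta_def power2_eq_square del: mult_fract flip: const_mult)

lemma hecke_prod_insert_left: "finite K \<Longrightarrow> i \<notin> K \<Longrightarrow>
    hecke_prod (insert i K) M = (\<Prod>j\<in>M. hecke i j) * hecke_prod K M"
  by (simp add: hecke_prod_def)

lemma hecke_prod_insert_right: "finite M \<Longrightarrow> j \<notin> M \<Longrightarrow>
    hecke_prod K (insert j M) = (\<Prod>i\<in>K. hecke i j) * hecke_prod K M"
  by (simp add: hecke_prod_def prod.distrib)

text \<open>After extraction of a common \<open>hecke_prod\<close>, the sum is a partial fraction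
  expansion at \<open>x k\<close>: the first identity over \<open>K - {k}\<close> if
  \<open>k\<close> lies in \<open>K\<close>, and the second over \<open>K\<close> otherwise. The
  \<open>- 1\<close> of the second identity becomes the correction term.\<close>

lemma chain_coeff_sum:
  assumes S: "finite S" "k \<in> S" and K: "K \<subseteq> S" "card K = Suc m"
  shows "(\<Sum>j\<in>K. chain_coeff S k j * hecke_prod (K - {j}) (S - K)) =
    theta ^ m * hecke_prod K (S - K) -
    (if k \<in> K then 0 else inverse theta * hecke_prod K (S - {k} - K))"
proof (cases "k \<in> K")
  case True
  define L where "L = K - {k}"
  define M where "M = S - K"
  have fin: "finite L" "finite M"
    using S K by (auto simp: L_def M_def intro: finite_subset)
  have card: "card L = m"
    using K S(1) True by (simp add: L_def)
  have KL: "K = insert k L" "k \<notin> L" "L \<inter> M = {}"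
    using True by (auto simp: L_def M_def)
  have Sj: "S - {k} - {j} = (L - {j}) \<union> M" if "j \<in> K" for j
    using K True that by (auto simp: L_def M_def)
  have c: "chain_coeff S k j * hecke_prod (K - {j}) M = hecke_prod K M *
      ((hecke j k - inverse theta) * (\<Prod>i\<in>L - {j}. hecke j i))" if "j \<in> L" for j
  proof -
    have "j \<in> K" "j \<noteq> k" "(L - {j}) \<inter> M = {}"
      using that KL by auto
    moreover have "K = insert j (K - {j})" "finite (K - {j})"
      using \<open>j \<in> K\<close> fin KL by auto
    then have "hecke_prod K M = (\<Prod>i\<in>M. hecke j i) * hecke_prod (K - {j}) M"
      by (metis hecke_prod_insert_left Diff_iff singletonI)
    ultimately show ?thesis
      using fin by (simp add: chain_coeff_def Sj prod.union_disjoint mult_ac)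
  qed
  have ck: "chain_coeff S k k * hecke_prod (K - {k}) M = hecke_prod K M * (\<Prod>i\<in>L. hecke k i)"
  proof -
    have "S - {k} - {k} = L \<union> M" "L \<union> M - {k} = L \<union> M"
      using K True by (auto simp: L_def M_def)
    then show ?thesis
      using fin KL by (simp add: chain_coeff_def prod.union_disjoint hecke_prod_insert_left mult_ac)
  qed
  have "(\<Sum>j\<in>K. chain_coeff S k j * hecke_prod (K - {j}) M) =
      hecke_prod K M * ((\<Prod>i\<in>L. hecke k i) +
        (\<Sum>j\<in>L. (hecke j k - inverse theta) * (\<Prod>i\<in>L - {j}. hecke j i)))"
    unfolding distrib_left sum_distrib_left
    by (subst KL(1), subst sum.insert) (use fin KL c ck in simp_all)
  also have "\<dots> = theta ^ m * hecke_prod K M"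
    using hecke_partial_fractions[of L x "x k" theta] fin KL card
    by (simp add: inj_on_def image_iff mult.commute)
  finally show ?thesis
    using True by (simp add: M_def)
next
  case False
  define M where "M = S - {k} - K"
  have fin: "finite K" "finite M"
    using S K by (auto simp: M_def intro: finite_subset)
  have SK: "S - K = insert k M" "k \<notin> M" "K \<inter> M = {}"
    using False S by (auto simp: M_def)
  have c: "chain_coeff S k j * hecke_prod (K - {j}) (S - K) = hecke_prod K M *
      ((hecke j k - inverse theta) * (\<Prod>i\<in>K - {j}. hecke j i * hecke i k))" if "j \<in> K" for j
  proof -
    have jk: "j \<noteq> k" "(K - {j}) \<inter> M = {}"
      using that False SK by auto
    have Sj: "S - {k} - {j} = (K - {j}) \<union> M"
      using K False that by (auto simp: M_def)
    have "K = insert j (K - {j})" "finite (K - {j})"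
      using that fin by auto
    then have "hecke_prod K M = (\<Prod>i\<in>M. hecke j i) * hecke_prod (K - {j}) M"
      by (metis hecke_prod_insert_left Diff_iff singletonI)
    then show ?thesis
      using fin jk SK
      by (simp add: chain_coeff_def Sj prod.union_disjoint prod.distrib hecke_prod_insert_right mult_ac)
  qed
  \<comment> \<open>The factor \<open>theta\<close> matches the form of
    \<open>hecke_partial_fractions'\<close> and is cancelled at the end.\<close>
  have "theta * (\<Sum>j\<in>K. chain_coeff S k j * hecke_prod (K - {j}) (S - K)) =
      hecke_prod K M * (theta * (\<Sum>j\<in>K. (hecke j k - inverse theta) * (\<Prod>i\<in>K - {j}. hecke j i * hecke i k)))"
    by (simp add: c mult_ac flip: sum_distrib_left)
  also have "\<dots> = hecke_prod K M * (theta ^ Suc m * (\<Prod>i\<in>K. hecke i k) - 1)"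
  proof -
    have "theta ^ 2 * x i \<noteq> x k" if "i \<in> K" for i
      using that False by (intro theta_square_mult_x_neq_x) auto
    then show ?thesis
      using fin False K(2) by (subst hecke_partial_fractions') (auto simp: inj_on_def)
  qed
  also have "\<dots> = theta * (theta ^ m * hecke_prod K (S - K) - inverse theta * hecke_prod K M)"
    using fin SK by (simp add: hecke_prod_insert_right algebra_simps)
  finally show ?thesis
    using False by (simp add: M_def del: right_diff_distrib right_diff_distrib')
qed

text \<open>Double counting: a pair of \<open>j\<close> and a set \<open>L\<close> avoiding
  \<open>j\<close> is the same as a set \<open>K\<close> with a marked element \<open>j\<close>. The
  coefficient of each \<open>G K\<close> is then given by \<open>chain_coeff_sum\<close>.\<close>

lemma chain_sum:
  assumes S: "finite S" "k \<in> S"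
  shows "(\<Sum>j\<in>S. chain_coeff S k j * subset_sum G (S - {j}) m {j}) =
    theta ^ m * subset_sum G S (Suc m) {} - inverse theta * subset_sum G (S - {k}) (Suc m) {}"
proof -
  let ?K = "{K. K \<subseteq> S \<and> card K = Suc m}"
  have fin: "finite ?K"
    using S by simp
  have "(\<Sum>j\<in>S. chain_coeff S k j * subset_sum G (S - {j}) m {j}) =
      (\<Sum>(j, L)\<in>(SIGMA j:S. {L. L \<subseteq> S - {j} \<and> card L = m}).
        chain_coeff S k j * hecke_prod L (S - {j} - L) * G (insert j L))"
    unfolding subset_sum_def sum_distrib_left using S by (subst sum.Sigma) (auto simp: mult.assoc)
  also have "\<dots> = (\<Sum>(K, j)\<in>(SIGMA K:?K. K).
        chain_coeff S k j * hecke_prod (K - {j}) (S - K) * G K)"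
  proof (rule sum.reindex_bij_witness[where i = "\<lambda>(K, j). (j, K - {j})" and j = "\<lambda>(j, L). (insert j L, j)"])
    fix p assume "p \<in> (SIGMA j:S. {L. L \<subseteq> S - {j} \<and> card L = m})"
    then obtain j L where p: "p = (j, L)" "j \<in> S" "L \<subseteq> S - {j}" "card L = m"
      by auto
    moreover have "finite L"
      using p S finite_subset by blast
    moreover have "j \<notin> L"
      using p by blast
    moreover have "S - {j} - L = S - insert j L"
      by blast
    ultimately show "(case case p of (j, L) \<Rightarrow> (insert j L, j) of (K, j) \<Rightarrow> (j, K - {j})) = p"
      "(case p of (j, L) \<Rightarrow> (insert j L, j)) \<in> (SIGMA K:?K. K)"
      "(case case p of (j, L) \<Rightarrow> (insert j L, j) of (K, j) \<Rightarrow>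
          chain_coeff S k j * hecke_prod (K - {j}) (S - K) * G K) =
        (case p of (j, L) \<Rightarrow> chain_coeff S k j * hecke_prod L (S - {j} - L) * G (insert j L))"
      by auto
  next
    fix p assume "p \<in> (SIGMA K:?K. K)"
    then obtain K j where p: "p = (K, j)" "K \<subseteq> S" "card K = Suc m" "j \<in> K"
      by auto
    moreover have "finite K"
      using p S finite_subset by blast
    ultimately show "(case case p of (K, j) \<Rightarrow> (j, K - {j}) of (j, L) \<Rightarrow> (insert j L, j)) = p"
      "(case p of (K, j) \<Rightarrow> (j, K - {j})) \<in> (SIGMA j:S. {L. L \<subseteq> S - {j} \<and> card L = m})"
      by auto
  qed
  also have "\<dots> = (\<Sum>K\<in>?K. (\<Sum>j\<in>K. chain_coeff S k j * hecke_prod (K - {j}) (S - K)) * G K)"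
    using fin S by (subst sum.Sigma[symmetric]) (auto simp: sum_distrib_right intro: finite_subset)
  also have "\<dots> = (\<Sum>K\<in>?K. theta ^ m * (hecke_prod K (S - K) * G K) -
      (if k \<in> K then 0 else inverse theta * (hecke_prod K (S - {k} - K) * G K)))"
    by (intro sum.cong refl) (simp add: chain_coeff_sum[OF S] left_diff_distrib mult.assoc)
  also have "\<dots> = theta ^ m * subset_sum G S (Suc m) {} -
      (\<Sum>K\<in>?K. if k \<in> K then 0 else inverse theta * (hecke_prod K (S - {k} - K) * G K))"
    by (simp add: sum_subtractf subset_sum_def sum_distrib_left)
  \<comment> \<open>The surviving sets, those avoiding \<open>k\<close>, are exactly the subsets of
    \<open>S - {k}\<close>.\<close>
  also have "(\<Sum>K\<in>?K. if k \<in> K then 0 else inverse theta * (hecke_prod K (S - {k} - K) * G K)) =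
      inverse theta * subset_sum G (S - {k}) (Suc m) {}"
    unfolding subset_sum_def sum_distrib_left using fin
    by (intro sum.mono_neutral_cong_right) (auto split: if_splits)
  finally show ?thesis .
qed

section \<open>The operators on functions with partial symmetry\<close>

definition permute :: "(nat \<Rightarrow> nat) \<Rightarrow> ratfun \<Rightarrow> ratfun" where
  "permute p = subst (\<lambda>i. x (p i))"

text \<open>The simultaneous shift of all variables in \<open>K\<close> as one substitution, which
  composes more easily than a product of operators \<open>Gamma i\<close>.\<close>

definition scaled :: "nat set \<Rightarrow> nat \<Rightarrow> ratfun" where
  "scaled K i = (if i \<in> K then q * x i else x i)"

lemma admissible_permute: "bij p \<Longrightarrow> admissible (\<lambda>i. x (p i))"
  using admissible_monomial[of p "\<lambda>_. 1"] by simp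

lemma admissible_scaled: "admissible (scaled K)"
proof -
  define c :: base where "c = Fract [:[:0, 1:]:] 1"
  have "c \<noteq> 0"
    by (simp add: c_def Zero_fract_def eq_fract)
  moreover have "scaled K = (\<lambda>i. const (if i \<in> K then c else 1) * x (id i))"
    by (auto simp: scaled_def c_def q_def)
  ultimately show ?thesis
    using admissible_monomial[of id "\<lambda>i. if i \<in> K then c else 1"] by auto
qed

lemma admissible_subst:
  assumes "admissible \<sigma>" "admissible \<tau>"
  shows "admissible (\<lambda>i. subst \<sigma> (\<tau> i))"
  unfolding admissible_def
proof (intro allI impI)
  fix p :: mpol
  assume "p \<noteq> 0"
  then show "subst_mpol (\<lambda>i. subst \<sigma> (\<tau> i)) p \<noteq> 0"
    using assms subst_eq_0_iff[OF assms(1), of "subst_mpol \<tau> p"]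
    by (simp add: subst_subst_mpol[OF assms(1)] admissible_def)
qed

lemmas subst_hom = subst_add subst_diff subst_mult subst_divide subst_inverse subst_power subst_powi
  subst_sum subst_prod subst_q subst_theta subst_x subst_0 subst_1

lemmas permute_hom = subst_hom[OF admissible_permute, folded permute_def]
lemmas scaled_hom = subst_hom[OF admissible_scaled]

lemma permute_permute: "bij p \<Longrightarrow> bij r \<Longrightarrow> permute p (permute r f) = permute (p \<circ> r) f"
  by (simp add: permute_def subst_subst admissible_permute subst_x)

lemma permute_id [simp]: "permute id f = f"
  using subst_id[of f] by (simp add: permute_def id_def)

lemma permute_hecke: "bij p \<Longrightarrow> permute p (hecke i j) = hecke (p i) (p j)"
  by (simp add: hecke_coeff_def permute_hom)

lemma permute_hecke_prod:
  assumes "bij p"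
  shows "permute p (hecke_prod K M) = hecke_prod (p ` K) (p ` M)"
proof -
  have "inj_on p A" for A
    using assms by (metis bij_is_inj inj_on_subset subset_UNIV)
  then show ?thesis
    using assms by (simp add: hecke_prod_def permute_hom permute_hecke prod.reindex)
qed

text \<open>Both coefficients and \<open>G\<close> are equivariant, so a permutation only moves the
  index sets. Every symmetry of a \<open>subset_sum\<close> below comes from this.\<close>

lemma permute_subset_sum:
  assumes p: "bij p" and S: "finite S"
    and G: "\<And>K. permute p (G K) = G (p ` K)"
  shows "permute p (subset_sum G S m R) = subset_sum G (p ` S) m (p ` R)"
proof -
  have inj: "inj p"
    using p by (simp add: bij_is_inj)
  have "permute p (subset_sum G S m R) =
      (\<Sum>L | L \<subseteq> S \<and> card L = m. hecke_prod (p ` L) (p ` S - p ` L) * G (p ` L \<union> p ` R))"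
    using p inj by (simp add: subset_sum_def permute_hom permute_hecke_prod G image_set_diff image_Un)
  also have "\<dots> = subset_sum G (p ` S) m (p ` R)"
    unfolding subset_sum_def
  proof (rule sum.reindex_bij_witness[where i = "\<lambda>L. inv p ` L" and j = "\<lambda>L. p ` L"])
    fix L assume L: "L \<in> {L. L \<subseteq> p ` S \<and> card L = m}"
    then show "p ` (inv p ` L) = L"
      using p by (simp add: image_comp bij_is_surj surj_f_inv_f)
    show "inv p ` L \<in> {L. L \<subseteq> S \<and> card L = m}"
    proof -
      have "inv p ` L \<subseteq> inv p ` p ` S"
        using L by blast
      then have "inv p ` L \<subseteq> S"
        using inj by (simp add: image_comp)
      moreover have "inj_on (inv p) L"
        using bij_imp_bij_inv[OF p] by (metis bij_is_inj inj_on_subset subset_UNIV)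
      ultimately show ?thesis
        using L by (simp add: card_image)
    qed
  qed (use inj in \<open>auto simp: image_comp card_image inj_on_subset\<close>)
  finally show ?thesis .
qed

section \<open>The operators \<open>rho_T\<close> and their products\<close>

lemma rho_s_eq: "rho_s i = permute (transpose i (i + 1))"
proof -
  have "x(i := x (i + 1), i + 1 := x i) = (\<lambda>j. x (transpose i (i + 1) j))"
    by (auto simp: fun_eq_iff transpose_def)
  then show ?thesis
    by (simp add: rho_s_def permute_def)
qed

text \<open>In this form the two coefficients differ by \<open>theta\<close>, so functions invariant
  under the transposition are visibly eigenfunctions.\<close>

lemma rho_T_eq: "rho_T i f =
    hecke i (i + 1) * permute (transpose i (i + 1)) f - (hecke i (i + 1) - theta) * f"
proof -
  have "x i - x (i + 1) \<noteq> 0"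
    by simp
  then have "x (i + 1) * ((theta - inverse theta) / (x i - x (i + 1))) = hecke i (i + 1) - theta"
    unfolding hecke_coeff_def by (simp add: divide_simps del: right_minus_eq x_eq_iff) (simp add: algebra_simps)
  then show ?thesis
    by (simp add: rho_T_def rho_s_eq hecke_coeff_def)
qed

lemma rho_T_add: "rho_T i (f + g) = rho_T i f + rho_T i g"
  by (simp add: rho_T_eq permute_hom algebra_simps)

lemma rho_T_mult:
  assumes "permute (transpose i (i + 1)) c = c"
  shows "rho_T i (c * f) = c * rho_T i f"
  using assms by (simp add: rho_T_eq permute_hom algebra_simps)

lemma rho_T_symmetric:
  assumes "permute (transpose i (i + 1)) f = f"
  shows "rho_T i f = theta * f"
  using assms by (simp add: rho_T_eq algebra_simps)

lemma rho_T_inv_symmetric: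
  assumes "permute (transpose i (i + 1)) f = f"
  shows "rho_T_inv i f = inverse theta * f"
  using assms by (simp add: rho_T_inv_def rho_T_symmetric)

lemma comp_list_Nil [simp]: "comp_list [] = id"
  and comp_list_Cons [simp]: "comp_list (F # Fs) f = F (comp_list Fs f)"
  by (simp_all add: comp_list_def)

lemma comp_list_append [simp]: "comp_list (Fs @ Gs) f = comp_list Fs (comp_list Gs f)"
  by (induction Fs) simp_all

lemma comp_list_rho_T_mult:
  assumes "\<And>i. i \<in> set is \<Longrightarrow> permute (transpose i (i + 1)) c = c"
  shows "comp_list (map rho_T is) (c * f) = c * comp_list (map rho_T is) f"
  using assms by (induction "is") (simp_all add: rho_T_mult)

lemma comp_list_rho_T_inv_symmetric:
  assumes "\<And>j. 1 \<le> j \<Longrightarrow> j < i \<Longrightarrow> permute (transpose j (j + 1)) f = f"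
  shows "comp_list (map rho_T_inv [1..<i]) f = inverse theta ^ (i - 1) * f"
  using assms
proof (induction i arbitrary: f)
  case (Suc i)
  show ?case
  proof (cases "i = 0")
    case False
    have "rho_T_inv i f = inverse theta * f"
      using Suc.prems[of i] False by (simp add: rho_T_inv_symmetric)
    moreover have "comp_list (map rho_T_inv [1..<i]) (inverse theta * f) =
        inverse theta ^ (i - 1) * (inverse theta * f)"
      using Suc.prems by (intro Suc.IH) (simp add: permute_hom)
    ultimately show ?thesis
      using False power_minus_mult[of i "inverse theta"] by (simp add: mult.assoc[symmetric])
  qed simp
qed simp

text \<open>Descending induction on \<open>k\<close>. In applying \<open>rho_T k\<close> to the
  expansion for \<open>k + 1\<close>, the term with \<open>j = k + 1\<close> produces the terms for
  \<open>k\<close> and \<open>k + 1\<close>; every other term keeps its \<open>j\<close>, with its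
  coefficient updated by the exchange identity.\<close>

lemma rho_T_chain:
  assumes "k \<le> N" and "\<And>i. k \<le> i \<Longrightarrow> i + 1 < N \<Longrightarrow> permute (transpose i (i + 1)) f = f"
  shows "comp_list (map rho_T [k..<N]) f =
    (\<Sum>j=k..N. chain_coeff {k..N} k j * permute (transpose j N) f)"
  using assms
proof (induction k rule: inc_induct)
  case base
  show ?case
    by (simp add: chain_coeff_def permute_id[unfolded id_def])
next
  case (step k)
  let ?s = "permute (transpose k (Suc k))" and ?a = "hecke k (Suc k)"
  \<comment> \<open>The factors at indices beyond \<open>k + 1\<close>, common to the coefficients
    at both levels.\<close>
  define C where "C j = (\<Prod>i\<in>{k+2..N} - {j}. hecke j i)" for j
  define P where "P j = permute (transpose j N) f" for j
  have IH: "comp_list (map rho_T [Suc k..<N]) f = (\<Sum>j=Suc k..N. chain_coeff {Suc k..N} (Suc k) j * P j)"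
    unfolding P_def using step.prems by (intro step.IH) auto
  have c1: "chain_coeff {Suc k..N} (Suc k) j = (if j = Suc k then 1 else hecke j (Suc k) - inverse theta) * C j" for j
  proof -
    have "{Suc k..N} - {Suc k} - {j} = {k+2..N} - {j}"
      by auto
    then show ?thesis
      by (simp add: chain_coeff_def C_def)
  qed
  have c2: "chain_coeff {k..N} k j = (hecke j k - inverse theta) * hecke j (Suc k) * C j" if "j \<in> {k+2..N}" for j
  proof -
    have "{k..N} - {k} - {j} = insert (Suc k) ({k+2..N} - {j})"
      using that by auto
    then show ?thesis
      using that by (simp add: chain_coeff_def C_def)
  qed
  have sets: "{Suc k..N} = insert (Suc k) {k+2..N}" "{k..N} = insert k (insert (Suc k) {k+2..N})"
    using step.hyps by auto
  have ck: "chain_coeff {k..N} k k = ?a * ?s (C (Suc k))"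
  proof -
    have "{k..N} - {k} - {k} = insert (Suc k) {k+2..N}" "{k+2..N} - {Suc k} = {k+2..N}"
      using step.hyps by auto
    moreover have "?s (\<Prod>i\<in>{k+2..N}. hecke (Suc k) i) = (\<Prod>i\<in>{k+2..N}. hecke k i)"
      by (simp add: permute_hom permute_hecke)
    ultimately show ?thesis
      by (simp add: chain_coeff_def C_def)
  qed
  have ck1: "chain_coeff {k..N} k (Suc k) = (hecke (Suc k) k - inverse theta) * C (Suc k)"
  proof -
    have "{k..N} - {k} - {Suc k} = {k+2..N} - {Suc k}"
      by auto
    then show ?thesis
      by (simp add: chain_coeff_def C_def)
  qed
  have sC: "?s (C j) = C j" if "j \<in> {k+2..N}" for j
    unfolding C_def using that
    by (simp add: permute_hom permute_hecke)
  have sP1: "?s (P (Suc k)) = P k"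
  \<comment> \<open>If \<open>Suc k = N\<close>, invariance of \<open>f\<close> under this
    transposition is not among the assumptions, but \<open>transpose (Suc k) N\<close> is then the
    identity. Otherwise conjugation turns one transposition into the other and \<open>f\<close>
    absorbs the rest.\<close>
  proof (cases "Suc k = N")
    case False
    have "transpose k (Suc k) \<circ> transpose (Suc k) N = transpose k N \<circ> transpose k (Suc k)"
      using False step.hyps by (auto simp: fun_eq_iff transpose_def)
    then have "?s (P (Suc k)) = permute (transpose k N) (?s f)"
      by (simp add: P_def permute_permute)
    then show ?thesis
      using step.prems[of k] False step.hyps by (simp add: P_def)
  qed (simp add: P_def)
  have sP: "?s (P j) = P j" if "j \<in> {k+2..N}" for j
  proof -
    have "?s f = f"
      using step.prems[of k] that by auto
    moreover have "transpose k (Suc k) \<circ> transpose j N = transpose j N \<circ> transpose k (Suc k)"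
      using that by (auto simp: fun_eq_iff transpose_def)
    then have "?s (P j) = permute (transpose j N) (?s f)"
      by (simp add: P_def permute_permute)
    ultimately show ?thesis
      by (simp add: P_def)
  qed
  have s1: "?s (chain_coeff {Suc k..N} (Suc k) (Suc k) * P (Suc k)) = ?s (C (Suc k)) * P k"
    by (simp add: c1 permute_hom sP1)
  have sj: "?s (chain_coeff {Suc k..N} (Suc k) j * P j) = (hecke j k - inverse theta) * C j * P j"
    if "j \<in> {k+2..N}" for j
    using that by (simp add: c1 permute_hom permute_hecke sC sP)
  have key: "?a * ((hecke j k - inverse theta) * C j * P j) -
      (?a - theta) * (chain_coeff {Suc k..N} (Suc k) j * P j) = chain_coeff {k..N} k j * P j"
    if j: "j \<in> {k+2..N}" for j
  proof -
    have "(hecke j k - inverse theta) * (hecke j (Suc k) - ?a) =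
        (hecke (Suc k) k - inverse theta) * (hecke j (Suc k) - inverse theta)"
      using j by (intro hecke_coeff_exchange) auto
    moreover have "?a - theta = inverse theta - hecke (Suc k) k"
      by (intro hecke_coeff_swap) simp
    ultimately have "?a * (hecke j k - inverse theta) - (?a - theta) * (hecke j (Suc k) - inverse theta) =
        (hecke j k - inverse theta) * hecke j (Suc k)"
      by algebra
    then show ?thesis
      using j unfolding c1 c2[OF j] by simp algebra
  qed
  have a: "?a - theta = inverse theta - hecke (Suc k) k"
    by (intro hecke_coeff_swap) simp
  have "comp_list (map rho_T [k..<N]) f = rho_T k (\<Sum>j=Suc k..N. chain_coeff {Suc k..N} (Suc k) j * P j)"
    using step.hyps by (simp add: upt_conv_Cons IH)
  also have "\<dots> = (\<Sum>j=Suc k..N. ?a * ?s (chain_coeff {Suc k..N} (Suc k) j * P j) -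
      (?a - theta) * (chain_coeff {Suc k..N} (Suc k) j * P j))"
    by (simp add: rho_T_eq permute_hom sum_subtractf sum_distrib_left)
  also have "\<dots> = ?a * (?s (C (Suc k)) * P k) - (?a - theta) * (C (Suc k) * P (Suc k)) +
      (\<Sum>j=k+2..N. ?a * ?s (chain_coeff {Suc k..N} (Suc k) j * P j) -
      (?a - theta) * (chain_coeff {Suc k..N} (Suc k) j * P j))"
    by (subst (1) sets) (simp add: s1, simp add: c1)
  also have "(\<Sum>j=k+2..N. ?a * ?s (chain_coeff {Suc k..N} (Suc k) j * P j) -
      (?a - theta) * (chain_coeff {Suc k..N} (Suc k) j * P j)) = (\<Sum>j=k+2..N. chain_coeff {k..N} k j * P j)"
    by (intro sum.cong refl) (simp add: sj key)
  also have "?a * (?s (C (Suc k)) * P k) - (?a - theta) * (C (Suc k) * P (Suc k)) +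
      (\<Sum>j=k+2..N. chain_coeff {k..N} k j * P j) = (\<Sum>j=k..N. chain_coeff {k..N} k j * P j)"
    by (subst (3) sets) (simp add: ck ck1 a algebra_simps)
  finally show ?case
    by (simp add: P_def)
qed

lemma transpose_image_same: "(a \<in> S \<longleftrightarrow> b \<in> S) \<Longrightarrow> transpose a b ` S = S"
  by (force simp: transpose_def image_iff split: if_splits)

lemma permute_prod_x:
  assumes "bij p"
  shows "permute p (\<Prod>i\<in>K. x i) = (\<Prod>i\<in>p ` K. x i)"
proof -
  have "inj_on p K"
    using assms by (metis bij_is_inj inj_on_subset subset_UNIV)
  then show ?thesis
    using assms by (simp add: permute_hom prod.reindex)
qed

lemma V_permute: "p permutes {1..N} \<Longrightarrow> f \<in> V N \<Longrightarrow> permute p f \<in> V N"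
  unfolding permute_def
  by (intro V_subst admissible_permute V_x) (auto simp: permutes_bij dest: permutes_in_image)

lemma V_scaled: "f \<in> V N \<Longrightarrow> subst (scaled K) f \<in> V N"
proof (intro V_subst admissible_scaled)
  fix i assume "i \<in> {1..N}"
  then show "scaled K i \<in> V N"
    by (simp only: scaled_def V_mult V_q V_x split: if_split) simp
qed

section \<open>The cyclic shift and the operators \<open>rho_Yn\<close>\<close>

definition cyc :: "nat \<Rightarrow> nat \<Rightarrow> nat" where
  "cyc N i = (if i = 1 then N else if i \<in> {2..N} then i - 1 else i)"

definition cyc_inv :: "nat \<Rightarrow> nat \<Rightarrow> nat" where
  "cyc_inv N i = (if i = N then 1 else if i \<in> {1..<N} then i + 1 else i)"

lemma cyc_permutes: "1 \<le> N \<Longrightarrow> cyc N permutes {1..N}"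
  by (intro bij_imp_permutes bij_betw_byWitness[where f' = "cyc_inv N"])
     (auto simp: cyc_def cyc_inv_def)

lemma cyc_inv_permutes: "1 \<le> N \<Longrightarrow> cyc_inv N permutes {1..N}"
  by (intro bij_imp_permutes bij_betw_byWitness[where f' = "cyc N"])
     (auto simp: cyc_def cyc_inv_def)

lemma cyc_image_initial: "1 \<le> i \<Longrightarrow> i \<le> N \<Longrightarrow> cyc N ` {1..i} = insert N {1..i - 1}"
proof -
  assume i: "1 \<le> i" "i \<le> N"
  then have "{1..i} = insert 1 (Suc ` {1..i - 1})"
    by (auto simp: image_Suc_atLeastAtMost)
  moreover have "cyc N ` Suc ` {1..i - 1} = {1..i - 1}"
    using i by (force simp: image_image cyc_def)
  moreover have "cyc N 1 = N"
    by (simp add: cyc_def)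
  ultimately show ?thesis
    by (metis image_insert)
qed

lemma cyc_image_final: "1 \<le> k \<Longrightarrow> cyc N ` {Suc k..N} = {k..<N}"
proof -
  assume k: "1 \<le> k"
  have "cyc N ` {Suc k..N} = (\<lambda>i. i - 1) ` {Suc k..N}"
    using k by (intro image_cong) (auto simp: cyc_def)
  also have "\<dots> = {k..<N}"
    by (force simp: image_iff)
  finally show ?thesis .
qed

text \<open>\<open>rho_pi N\<close> is injective, and the right-hand side is an explicit preimage of
  \<open>f\<close> lying in \<open>V N\<close>, so \<open>inv_into\<close> must return it.\<close>

lemma rho_pi_inv_eq:
  assumes N: "1 \<le> N" and f: "f \<in> V N"
  shows "rho_pi_inv N f = subst (scaled {N}) (permute (cyc N) f)"
proof -
  define \<sigma> where "\<sigma> i = (if i = N then inverse q * x 1 else if i \<in> {1..<N} then x (i + 1) else x i)" for i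
  define c :: base where "c = Fract [:[:0, 1:]:] 1"
  have qc: "q = const c"
    by (simp add: q_def c_def)
  have "c \<noteq> 0"
    by (simp add: c_def Zero_fract_def eq_fract)
  moreover have "\<sigma> = (\<lambda>i. const (if i = N then inverse c else 1) * x (cyc_inv N i))"
    by (auto simp: \<sigma>_def cyc_inv_def qc const_inverse)
  ultimately have adm: "admissible \<sigma>"
    using admissible_monomial[of "cyc_inv N" "\<lambda>i. if i = N then inverse c else 1"]
      permutes_bij[OF cyc_inv_permutes[OF N]] by auto
  have pi: "rho_pi N = subst \<sigma>"
    by (simp only: rho_pi_def \<sigma>_def[abs_def])
  have bij: "bij (cyc N)"
    using cyc_permutes[OF N] permutes_bij by blast
  define g where "g = subst (scaled {N}) (permute (cyc N) f)"
  have "g \<in> V N"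
    unfolding g_def by (intro V_scaled V_permute cyc_permutes N f)
  have "subst \<sigma> (scaled {N} (cyc N i)) = x i" for i
    using N by (cases "i = 1"; cases "i \<in> {2..N}")
      (auto simp: scaled_def subst_mult[OF adm] subst_q[OF adm] subst_x[OF adm] \<sigma>_def cyc_def)
  moreover have "g = subst (\<lambda>i. scaled {N} (cyc N i)) f"
    using bij by (simp add: g_def permute_def subst_subst admissible_scaled admissible_permute
      subst_x)
  moreover have "admissible (\<lambda>i. scaled {N} (cyc N i))"
    using admissible_subst[OF admissible_scaled[of "{N}"] admissible_permute[OF bij]]
    by (simp add: subst_x admissible_scaled)
  ultimately have "rho_pi N g = f"
    by (simp add: pi subst_subst[OF adm] subst_id)
  moreover have "inj_on (rho_pi N) (V N)"
    by (simp add: inj_on_def pi subst_inject[OF adm])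
  ultimately show ?thesis
    unfolding rho_pi_inv_def using \<open>g \<in> V N\<close> g_def by (metis inv_into_f_f)
qed

text \<open>Each inverse operator \<open>rho_T_inv j\<close> acts by \<open>inverse theta\<close>.
  The cyclic shift turns the product of the first \<open>i\<close> variables into
  \<open>q * x N\<close> times the product of the first \<open>i - 1\<close>; the latter commutes
  with the remaining \<open>rho_T\<close> and cancels against the leftmost factor of
  \<open>rho_Yn\<close>.\<close>

lemma rho_Yn_symmetric:
  assumes i: "1 \<le> i" "i \<le> N" and f: "f \<in> V N"
    and sym: "\<And>j. 1 \<le> j \<Longrightarrow> j < i \<Longrightarrow> permute (transpose j (j + 1)) f = f"
  shows "rho_Yn N n i f = q powi n * inverse theta ^ (i - 1) *
    comp_list (map rho_T [i..<N]) (x N powi n * subst (scaled {N}) (permute (cyc N) f))"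
proof -
  have N: "1 \<le> N"
    using i by simp
  have bij: "bij (cyc N)"
    using cyc_permutes[OF N] permutes_bij by blast
  define X where "X = (\<Prod>j=1..i. x j)"
  define Y where "Y = (\<Prod>j=1..i - 1. x j)"
  define g where "g = x N powi n * subst (scaled {N}) (permute (cyc N) f)"
  have "permute (transpose j (j + 1)) (X powi n * f) = X powi n * f" if "1 \<le> j" "j < i" for j
  proof -
    have "transpose j (j + 1) ` {1..i} = {1..i}"
      using that by (intro transpose_image_same) auto
    then have "permute (transpose j (j + 1)) X = X"
      unfolding X_def by (subst permute_prod_x) (simp_all del: One_nat_def)
    then show ?thesis
      using sym[OF that] by (simp add: permute_hom(3,7))
  qed
  then have inv: "comp_list (map rho_T_inv [1..<i]) (X powi n * f) = inverse theta ^ (i - 1) * (X powi n * f)"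
    by (rule comp_list_rho_T_inv_symmetric)
  have "X \<in> V N"
    unfolding X_def using i by (intro V_prod V_x) auto
  then have XV: "inverse theta ^ (i - 1) * (X powi n * f) \<in> V N"
    using f by (intro V_mult V_power V_inverse V_theta V_powi)
  have "permute (cyc N) X = x N * Y"
    unfolding X_def Y_def using i by (simp only: permute_prod_x[OF bij] cyc_image_initial) auto
  moreover have "subst (scaled {N}) Y = Y"
    unfolding Y_def scaled_hom using i by (intro prod.cong refl) (auto simp: scaled_def)
  ultimately have "rho_pi_inv N (inverse theta ^ (i - 1) * (X powi n * f)) =
      inverse theta ^ (i - 1) * q powi n * Y powi n * g"
    unfolding rho_pi_inv_eq[OF N XV] g_def using bij
    by (simp add: permute_hom scaled_hom)
       (simp add: scaled_def power_int_mult_distrib mult_ac)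
  moreover have "comp_list (map rho_T [i..<N]) (inverse theta ^ (i - 1) * q powi n * Y powi n * g) =
      inverse theta ^ (i - 1) * q powi n * Y powi n * comp_list (map rho_T [i..<N]) g"
  proof (rule comp_list_rho_T_mult)
    fix j assume "j \<in> set [i..<N]"
    then have "transpose j (j + 1) ` {1..i - 1} = {1..i - 1}"
      by (intro transpose_image_same) auto
    then have "permute (transpose j (j + 1)) Y = Y"
      unfolding Y_def by (subst permute_prod_x) (simp_all del: One_nat_def)
    then show "permute (transpose j (j + 1)) (inverse theta ^ (i - 1) * q powi n * Y powi n) =
        inverse theta ^ (i - 1) * q powi n * Y powi n"
      by (simp add: permute_hom)
  qed
  moreover have "rho_Yn N n i f = Y powi (- n) * comp_list (map rho_T [i..<N])
      (rho_pi_inv N (inverse theta ^ (i - 1) * (X powi n * f)))"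
    by (simp only: rho_Yn_def rho_X_powi_def rho_Y_def o_apply inv flip: X_def Y_def)
  ultimately have "rho_Yn N n i f = (Y powi (- n) * Y powi n) *
      (q powi n * inverse theta ^ (i - 1) * comp_list (map rho_T [i..<N]) g)"
    by (simp only: mult_ac)
  moreover have "Y powi (- n) * Y powi n = 1"
    by (simp add: Y_def power_int_minus)
  ultimately show ?thesis
    by (simp only: g_def mult_1_left)
qed

section \<open>Additivity of \<open>rho_Yn\<close> and invariance of \<open>V N\<close>\<close>

lemma comp_list_add:
  assumes "\<And>F f g. F \<in> set Fs \<Longrightarrow> F (f + g) = F f + F g"
  shows "comp_list Fs (f + g) = comp_list Fs f + comp_list Fs (g :: 'a :: plus)"
  using assms by (induction Fs) simp_all

lemma V_comp_list:
  assumes "\<And>F g. F \<in> set Fs \<Longrightarrow> g \<in> V N \<Longrightarrow> F g \<in> V N" "f \<in> V N"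
  shows "comp_list Fs f \<in> V N"
  using assms by (induction Fs) simp_all

lemma rho_T_inv_add: "rho_T_inv i (f + g) = rho_T_inv i f + rho_T_inv i g"
  by (simp add: rho_T_inv_def rho_T_add algebra_simps)

lemma V_hecke: "i \<in> {1..N} \<Longrightarrow> j \<in> {1..N} \<Longrightarrow> hecke i j \<in> V N"
  unfolding hecke_coeff_def by (intro V_divide V_diff V_mult V_inverse V_theta V_x)

lemma V_rho_T: "1 \<le> i \<Longrightarrow> i < N \<Longrightarrow> f \<in> V N \<Longrightarrow> rho_T i f \<in> V N"
  unfolding rho_T_eq
  by (intro V_diff V_mult V_hecke V_theta V_permute permutes_swap_id) auto

lemma V_rho_T_inv: "1 \<le> i \<Longrightarrow> i < N \<Longrightarrow> f \<in> V N \<Longrightarrow> rho_T_inv i f \<in> V N"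
  unfolding rho_T_inv_def by (intro V_diff V_add V_mult V_rho_T V_inverse V_theta)

lemma V_rho_X_powi: "k \<le> N \<Longrightarrow> f \<in> V N \<Longrightarrow> rho_X_powi k n f \<in> V N"
  unfolding rho_X_powi_def by (intro V_mult V_powi V_prod V_x) auto

lemma V_rho_pi_inv: "1 \<le> N \<Longrightarrow> f \<in> V N \<Longrightarrow> rho_pi_inv N f \<in> V N"
  by (simp only: rho_pi_inv_eq, intro V_scaled V_permute cyc_permutes)

lemma V_rho_Yn:
  assumes "1 \<le> i" "i \<le> N" "f \<in> V N"
  shows "rho_Yn N n i f \<in> V N"
  unfolding rho_Yn_def rho_Y_def o_apply using assms
  by (intro V_rho_X_powi V_comp_list V_rho_pi_inv) (auto intro: V_rho_T V_rho_T_inv V_rho_X_powi)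

lemma rho_Yn_add:
  assumes "1 \<le> i" "i \<le> N" "f \<in> V N" "g \<in> V N"
  shows "rho_Yn N n i (f + g) = rho_Yn N n i f + rho_Yn N n i g"
proof -
  define Z where "Z h = comp_list (map rho_T_inv [1..<i]) (rho_X_powi i n h)" for h
  have N: "1 \<le> N"
    using assms by simp
  have Z: "Z (f + g) = Z f + Z g"
    by (simp add: Z_def rho_X_powi_def distrib_left) (auto intro!: comp_list_add rho_T_inv_add)
  have ZV: "Z h \<in> V N" if "h \<in> V N" for h
    unfolding Z_def using assms that by (intro V_comp_list) (auto intro: V_rho_T_inv V_rho_X_powi)
  have "rho_pi_inv N (Z f + Z g) = rho_pi_inv N (Z f) + rho_pi_inv N (Z g)"
    using assms permutes_bij[OF cyc_permutes[OF N]]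
    by (simp add: rho_pi_inv_eq N ZV V_add permute_hom scaled_hom)
  moreover have "comp_list (map rho_T [i..<N]) (h + k) =
      comp_list (map rho_T [i..<N]) h + comp_list (map rho_T [i..<N]) k" for h k
    by (intro comp_list_add) (auto simp: rho_T_add)
  moreover have "rho_Yn N n i h =
      rho_X_powi (i - 1) (- n) (comp_list (map rho_T [i..<N]) (rho_pi_inv N (Z h)))" for h
    by (simp add: rho_Yn_def rho_Y_def Z_def)
  ultimately show ?thesis
    by (simp add: Z rho_X_powi_def distrib_left)
qed

lemma rho_Yn_sum:
  assumes i: "1 \<le> i" "i \<le> N" and "finite A" "\<And>a. a \<in> A \<Longrightarrow> f a \<in> V N"
  shows "rho_Yn N n i (sum f A) = (\<Sum>a\<in>A. rho_Yn N n i (f a))"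
  using assms(3,4)
proof (induction A rule: finite_induct)
  case empty
  \<comment> \<open>The value at 0 is extracted from additivity.\<close>
  have "rho_Yn N n i (0 + 0) = rho_Yn N n i 0 + rho_Yn N n i 0"
    using i V_0 by (intro rho_Yn_add)
  then show ?case
    by (simp only: add_0_left add_cancel_left_left add_cancel_left_right add_cancel_right_right sum.empty)
next
  case (insert a A)
  then show ?case
    using i by (simp add: rho_Yn_add V_sum)
qed

section \<open>Sums of ordered products of the operators \<open>rho_Yn\<close>\<close>

definition Y_sum :: "nat \<Rightarrow> int \<Rightarrow> nat \<Rightarrow> nat \<Rightarrow> ratfun \<Rightarrow> ratfun" where
  "Y_sum N n k m f =
    (\<Sum>I | I \<subseteq> {k..N} \<and> card I = m. comp_list (map (rho_Yn N n) (sorted_list_of_set I)) f)"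

lemma V_Y_product:
  assumes "I \<subseteq> {1..N}" "f \<in> V N"
  shows "comp_list (map (rho_Yn N n) (sorted_list_of_set I)) f \<in> V N"
proof -
  have "finite I"
    using assms(1) finite_subset by blast
  then show ?thesis
    using assms by (intro V_comp_list) (auto intro!: V_rho_Yn)
qed

lemma V_Y_sum: "1 \<le> k \<Longrightarrow> f \<in> V N \<Longrightarrow> Y_sum N n k m f \<in> V N"
  unfolding Y_sum_def by (intro V_sum V_Y_product) auto

text \<open>The subsets are split according to whether they contain \<open>k\<close>. Being the
  least index, \<open>k\<close> heads the sorted list, so \<open>rho_Yn N n k\<close> is the
  outermost operator.\<close>

lemma Y_sum_Suc:
  assumes k: "1 \<le> k" "k \<le> N" and f: "f \<in> V N"
  shows "Y_sum N n k (Suc m) f = Y_sum N n (Suc k) (Suc m) f + rho_Yn N n k (Y_sum N n (Suc k) m f)"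
proof -
  let ?F = "\<lambda>I. comp_list (map (rho_Yn N n) (sorted_list_of_set I)) f"
  let ?A = "{I. I \<subseteq> {Suc k..N} \<and> card I = Suc m}" and ?B = "{I. I \<subseteq> {Suc k..N} \<and> card I = m}"
  have fin: "finite I" if "I \<subseteq> {Suc k..N}" for I
    using that finite_subset by blast
  have nin: "k \<notin> I" if "I \<subseteq> {Suc k..N}" for I
    using that by auto
  have "{I. I \<subseteq> {k..N} \<and> card I = Suc m} = ?A \<union> insert k ` ?B"
  proof (intro equalityI subsetI)
    fix I assume I: "I \<in> {I. I \<subseteq> {k..N} \<and> card I = Suc m}"
    then have "finite I"
      using finite_subset by blast
    show "I \<in> ?A \<union> insert k ` ?B"
    proof (cases "k \<in> I")
      case True
      have "I - {k} \<subseteq> {Suc k..N}"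
        using I by force
      moreover have "card (I - {k}) = m"
        using True I \<open>finite I\<close> by simp
      moreover have "I = insert k (I - {k})"
        using True by auto
      ultimately show ?thesis
        by blast
    next
      case False
      have "I \<subseteq> {Suc k..N}"
      proof
        fix i assume "i \<in> I"
        then have "i \<noteq> k" "i \<in> {k..N}"
          using I False by auto
        then show "i \<in> {Suc k..N}"
          by auto
      qed
      then show ?thesis
        using I by auto
    qed
  next
    fix I assume "I \<in> ?A \<union> insert k ` ?B"
    then show "I \<in> {I. I \<subseteq> {k..N} \<and> card I = Suc m}"
      using k fin nin by (auto simp: card_insert_disjoint)
  qed
  then have "Y_sum N n k (Suc m) f = sum ?F ?A + sum ?F (insert k ` ?B)"
    unfolding Y_sum_def by (simp, intro sum.union_disjoint) (auto dest: nin)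
  also have "sum ?F (insert k ` ?B) = (\<Sum>I\<in>?B. ?F (insert k I))"
    by (rule sum.reindex_cong[of "insert k"]) (auto simp: inj_on_def dest: nin)
  also have "\<dots> = (\<Sum>I\<in>?B. rho_Yn N n k (?F I))"
  proof (intro sum.cong refl)
    fix I assume I: "I \<in> ?B"
    have "Min (insert k I) = k"
      using I fin by (intro Min_eqI) auto
    then have "sorted_list_of_set (insert k I) = k # sorted_list_of_set I"
      using I fin nin sorted_list_of_set_nonempty[of "insert k I"] by simp
    then show "?F (insert k I) = rho_Yn N n k (?F I)"
      by simp
  qed
  also have "\<dots> = rho_Yn N n k (Y_sum N n (Suc k) m f)"
    unfolding Y_sum_def using k f
    by (intro rho_Yn_sum[symmetric] V_Y_product) auto
  finally show ?thesis
    by (simp add: Y_sum_def)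
qed

definition scaled_term :: "int \<Rightarrow> ratfun \<Rightarrow> nat set \<Rightarrow> ratfun" where
  "scaled_term n f K = (\<Prod>i\<in>K. x i) powi n * subst (scaled K) f"

lemma scaled_insert:
  "i \<notin> K \<Longrightarrow> subst (scaled {i}) (subst (scaled K) f) = subst (scaled (insert i K)) f"
  by (simp add: subst_subst admissible_scaled)
     (rule arg_cong[where f = "\<lambda>s. subst s f"], auto simp: scaled_def scaled_hom admissible_scaled fun_eq_iff)

lemma permute_scaled_term:
  assumes p: "bij p" and f: "permute p f = f"
  shows "permute p (scaled_term n f K) = scaled_term n f (p ` K)"
proof -
  have "permute p (scaled K i) = scaled (p ` K) (p i)" for i
    using p by (auto simp: scaled_def permute_hom bij_def inj_def)
  then have "permute p (subst (scaled K) f) = subst (\<lambda>i. scaled (p ` K) (p i)) f"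
    using p by (simp add: permute_def subst_subst admissible_permute admissible_scaled)
  also have "\<dots> = subst (scaled (p ` K)) (permute p f)"
    using p by (simp add: permute_def subst_subst admissible_permute admissible_scaled subst_x)
  finally show ?thesis
    using p f by (simp add: scaled_term_def permute_hom(3,7) permute_prod_x)
qed

text \<open>As \<open>N\<close> is outside \<open>S\<close>, the coefficients do not involve
  \<open>x N\<close>; the shift and the power of \<open>x N\<close> only adjoin \<open>N\<close> to
  each index set of \<open>scaled_term\<close>.\<close>

lemma scaled_subset_sum:
  assumes "finite S" "N \<notin> S"
  shows "x N powi n * subst (scaled {N}) (subset_sum (scaled_term n f) S m {}) =
    subset_sum (scaled_term n f) S m {N}"
proof -
  have hecke: "subst (scaled {N}) (hecke i j) = hecke i j" if "i \<in> S" "j \<in> S" for i j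
    using that assms(2) by (simp add: hecke_coeff_def scaled_hom) (auto simp: scaled_def)
  have "x N powi n * subst (scaled {N}) (hecke_prod L (S - L) * scaled_term n f L) =
      hecke_prod L (S - L) * scaled_term n f (insert N L)" if "L \<subseteq> S" for L
  proof -
    have "subst (scaled {N}) (hecke_prod L (S - L)) = hecke_prod L (S - L)"
      unfolding hecke_prod_def scaled_hom using that by (intro prod.cong refl hecke) auto
    moreover have "subst (scaled {N}) (\<Prod>i\<in>L. x i) = (\<Prod>i\<in>L. x i)"
      unfolding scaled_hom using that assms(2) by (intro prod.cong refl) (auto simp: scaled_def)
    moreover have "finite L" "N \<notin> L"
      using that assms finite_subset by auto
    ultimately show ?thesis
      by (simp add: scaled_term_def scaled_hom(3,7) scaled_insert power_int_mult_distrib mult_ac)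
  qed
  then show ?thesis
    unfolding subset_sum_def scaled_hom sum_distrib_left by (intro sum.cong refl) (simp add: scaled_hom)
qed

lemma Sym_permute: "f \<in> Sym N \<Longrightarrow> p permutes {1..N} \<Longrightarrow> permute p f = f"
  by (simp add: Sym_def permute_def)

text \<open>The descending induction of the overview. The chain of \<open>rho_T\<close> yields a
  difference of two subset sums, the second of which cancels the contribution of the subsets
  avoiding \<open>k\<close>.\<close>

lemma Y_sum_eq:
  assumes f: "f \<in> Sym N" and k: "1 \<le> k" "k \<le> Suc N"
  shows "Y_sum N n k m f = q powi (int m * n) * inverse theta ^ (m * (k - 1)) *
    subset_sum (scaled_term n f) {k..N} m {}"
  using k(2,1)
proof (induction k arbitrary: m rule: inc_induct)
  \<comment> \<open>Here \<open>{Suc N..N}\<close> is empty: both sides are \<open>f\<close> for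
    \<open>m = 0\<close> and zero otherwise.\<close>
  case base
  have "{I :: nat set. I = {} \<and> card I = m} = (if m = 0 then {{}} else {})"
    by auto
  moreover have "subst (scaled {}) f = f"
    using subst_id[of f] by (simp add: scaled_def[abs_def])
  ultimately show ?case
    by (simp add: Y_sum_def subset_sum_def hecke_prod_def scaled_term_def)
next
  case (step k)
  let ?G = "scaled_term n f"
  have fV: "f \<in> V N"
    using f by (simp add: Sym_def)
  have kN: "k \<le> N"
    using step.hyps by simp
  have N: "1 \<le> N"
    using step.prems kN by simp
  have zero: "subset_sum ?G S 0 {} = f" if "finite S" for S
  proof -
    have "{L. L \<subseteq> S \<and> card L = 0} = {{}}"
      using that by (auto simp: card_eq_0_iff dest: finite_subset)
    moreover have "subst (scaled {}) f = f"
      using subst_id[of f] by (simp add: scaled_def[abs_def])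
    ultimately show ?thesis
      by (simp add: subset_sum_def hecke_prod_def scaled_term_def)
  qed
  have Gp: "permute p (?G K) = ?G (p ` K)" if "p permutes {1..N}" for p K
    using that f by (intro permute_scaled_term Sym_permute permutes_bij)
  have Gt: "permute (transpose i j) (?G K) = ?G (transpose i j ` K)" if "i \<in> {1..N}" "j \<in> {1..N}" for i j K
    using that by (intro Gp permutes_swap_id)
  show ?case
  proof (cases m)
    case 0
    have "{I. I \<subseteq> {k..N} \<and> card I = 0} = {{}}"
      by (auto simp: card_eq_0_iff dest: finite_subset)
    then show ?thesis
      using zero[of "{k..N}"] by (simp add: 0 Y_sum_def)
  next
    case (Suc m')
    define C where "C = q powi (int m' * n) * inverse theta ^ (m' * k)"
    define h where "h = subset_sum ?G {Suc k..N} m' {}"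
    define F where "F = subset_sum ?G {k..<N} m' {N}"
    have IH: "Y_sum N n (Suc k) m' f = C * h"
      using step.IH[of m'] by (simp add: C_def h_def)
    \<comment> \<open>Up to the nonzero constant \<open>C\<close>, \<open>h\<close> is a
      \<open>Y_sum\<close>, whose membership in \<open>V N\<close> is known.\<close>
    have "h \<in> V N"
    proof -
      have "Y_sum N n (Suc k) m' f \<in> V N"
        using fV by (intro V_Y_sum) auto
      moreover have "C \<noteq> 0" "C \<in> V N"
        unfolding C_def by (auto intro!: V_mult V_powi V_power V_inverse V_q V_theta)
      ultimately show ?thesis
        using V_divide[of "C * h" N C] IH by simp
    qed
    have C: "permute p C = C" if "bij p" for p
      using that by (simp add: C_def permute_hom)
    have hs: "permute (transpose j (j + 1)) h = h" if j: "1 \<le> j" "j < k" for j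
    proof -
      have "transpose j (j + 1) ` {Suc k..N} = {Suc k..N}"
        using j by (intro transpose_image_same) auto
      then show ?thesis
        unfolding h_def using j kN by (subst permute_subset_sum) (auto simp: Gt)
    qed
    have Fs: "permute (transpose i (i + 1)) F = F" if i: "k \<le> i" "i + 1 < N" for i
    proof -
      have "transpose i (i + 1) ` {k..<N} = {k..<N}" "transpose i (i + 1) ` {N} = {N}"
        using i by (intro transpose_image_same; auto)+
      then show ?thesis
        unfolding F_def using i step.prems by (subst permute_subset_sum) (auto simp: Gt)
    qed
    \<comment> \<open>Exchanging \<open>j\<close> and \<open>N\<close> brings each term of the chain
      expansion into the form summed in \<open>chain_sum\<close>.\<close>
    have Fj: "permute (transpose j N) F = subset_sum ?G ({k..N} - {j}) m' {j}" if j: "j \<in> {k..N}" for j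
    proof -
      have "transpose j N ` {k..<N} = transpose j N ` ({k..N} - {N})"
        by (intro arg_cong[where f = "image _"]) auto
      also have "\<dots> = transpose j N ` {k..N} - transpose j N ` {N}"
        by (intro image_set_diff) (simp add: bij_is_inj)
      also have "\<dots> = {k..N} - {j}"
        using j transpose_image_same[of j "{k..N}" N] by simp
      finally show ?thesis
        unfolding F_def using j step.prems by (subst permute_subset_sum) (auto simp: Gt)
    qed
    have cyc: "x N powi n * subst (scaled {N}) (permute (cyc N) h) = F"
    proof -
      have "permute (cyc N) h = subset_sum ?G {k..<N} m' {}"
        unfolding h_def using cyc_permutes[OF N] step.prems
        by (subst permute_subset_sum) (auto simp: Gp permutes_bij cyc_image_final)
      then show ?thesis
        by (simp add: scaled_subset_sum F_def)
    qed
    have "rho_Yn N n k (C * h) = q powi n * inverse theta ^ (k - 1) *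
        comp_list (map rho_T [k..<N]) (x N powi n * subst (scaled {N}) (permute (cyc N) (C * h)))"
      using step.prems kN \<open>h \<in> V N\<close> hs C
      by (intro rho_Yn_symmetric)
         (auto simp: permute_hom(3) C_def intro!: V_mult V_powi V_power V_inverse V_q V_theta)
    also have "x N powi n * subst (scaled {N}) (permute (cyc N) (C * h)) = C * F"
    proof -
      have "subst (scaled {N}) C = C"
        by (simp add: C_def scaled_hom)
      then show ?thesis
        using permutes_bij[OF cyc_permutes[OF N]] cyc
        by (simp add: permute_hom(3) scaled_hom(3) C mult.left_commute)
    qed
    also have "comp_list (map rho_T [k..<N]) (C * F) = C * comp_list (map rho_T [k..<N]) F"
      by (intro comp_list_rho_T_mult C) simp
    also have "comp_list (map rho_T [k..<N]) F = theta ^ m' * subset_sum ?G {k..N} m {} -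
        inverse theta * subset_sum ?G {Suc k..N} m {}"
    proof -
      have "{k..N} - {k} = {Suc k..N}"
        by auto
      then show ?thesis
        using chain_sum[of "{k..N}" k ?G m'] kN rho_T_chain[OF kN Fs]
        by (simp add: Fj Suc)
    qed
    finally have Y: "rho_Yn N n k (C * h) = q powi n * inverse theta ^ (k - 1) *
        (C * (theta ^ m' * subset_sum ?G {k..N} m {} - inverse theta * subset_sum ?G {Suc k..N} m {}))" .
    have qp: "q powi n * q powi (int m' * n) = q powi (int m * n)"
      by (simp add: Suc algebra_simps flip: power_int_add)
    obtain k' where k': "k = Suc k'"
      using step.prems by (cases k) auto
    \<comment> \<open>Exponent count with \<open>m = m' + 1\<close>:
      \<open>(k - 1) + m' * k - m' = m * (k - 1)\<close>, and
      \<open>(k - 1) + m' * k + 1 = m * k\<close>. The latter is the power in the induction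
      hypothesis for \<open>m\<close>, so those terms cancel.\<close>
    have e1: "inverse theta ^ (k - 1) * inverse theta ^ (m' * k) * theta ^ m' = inverse theta ^ (m * (k - 1))"
      by (simp add: k' Suc power_add power_inverse field_simps)
    have e2: "inverse theta ^ (k - 1) * inverse theta ^ (m' * k) * inverse theta = inverse theta ^ (m * k)"
      by (simp add: k' Suc power_add power_inverse field_simps)
    have "Y_sum N n k m f = q powi (int m * n) * inverse theta ^ (m * k) * subset_sum ?G {Suc k..N} m {} +
        rho_Yn N n k (C * h)"
      using Y_sum_Suc[OF step.prems kN fV, of n m'] step.IH[of m] by (simp add: IH flip: Suc)
    also have "rho_Yn N n k (C * h) = (q powi n * q powi (int m' * n)) *
        ((inverse theta ^ (k - 1) * inverse theta ^ (m' * k) * theta ^ m') * subset_sum ?G {k..N} m {} -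
        (inverse theta ^ (k - 1) * inverse theta ^ (m' * k) * inverse theta) * subset_sum ?G {Suc k..N} m {})"
      unfolding Y by (simp add: C_def algebra_simps)
    finally show ?thesis
      unfolding qp e1 e2 by (simp add: algebra_simps)
  qed
qed

section \<open>Comparison with the generalized Macdonald operators\<close>

lemma Gamma_set_eq:
  assumes "finite I"
  shows "Gamma_set I f = subst (scaled I) f"
proof -
  have G: "Gamma i = subst (scaled {i})" for i
    unfolding Gamma_def by (rule arg_cong[where f = subst]) (auto simp: scaled_def)
  have "comp_list (map Gamma is) f = subst (scaled (set is)) f" if "distinct is" for "is"
    using that
  proof (induction "is")
    case Nil
    then show ?case
      using subst_id[of f] by (simp add: scaled_def[abs_def])
  qed (simp add: G scaled_insert)
  then show ?thesis
    using assms by (simp add: Gamma_set_def)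
qed

text \<open>At \<open>k = 1\<close> the power of \<open>inverse theta\<close> is trivial, and the
  power of \<open>q\<close> cancels the normalization in \<open>rho_D\<close>.\<close>

lemma rho_D_eq:
  assumes "1 \<le> N" "f \<in> Sym N"
  shows "rho_D N \<alpha> n f = subset_sum (scaled_term n f) {1..N} \<alpha> {}"
proof -
  have "rho_D N \<alpha> n f = q powi (- (int \<alpha> * n)) * Y_sum N n 1 \<alpha> f"
    by (simp add: rho_D_def Y_sum_def)
  also have "\<dots> = subset_sum (scaled_term n f) {1..N} \<alpha> {}"
    using assms by (simp add: Y_sum_eq power_int_minus)
  finally show ?thesis .
qed

theorem theorem2p17:
  fixes N \<alpha> :: nat and n :: int
  assumes "N \<ge> 1" and "\<alpha> \<le> N"
  shows "rho_D N \<alpha> n ` Sym N \<subseteq> Sym N \<and>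
    (\<forall>f\<in>Sym N.
       rho_D N \<alpha> n f =
         (\<Sum>I | I \<subseteq> {1..N} \<and> card I = \<alpha>.
            (\<Prod>i\<in>I. x i) powi n *
            (\<Prod>i\<in>I. \<Prod>j\<in>{1..N} - I. (theta * x i - inverse theta * x j) / (x i - x j)) *
            Gamma_set I f) \<and>
       rho_D N \<alpha> n f = theta powi (- int (\<alpha> * (N - \<alpha>))) * gen_Macdonald N \<alpha> n f)"
proof (intro conjI ballI)
  show "rho_D N \<alpha> n ` Sym N \<subseteq> Sym N"
  proof (rule image_subsetI)
    fix f assume f: "f \<in> Sym N"
    have "subset_sum (scaled_term n f) {1..N} \<alpha> {} \<in> V N"
      unfolding subset_sum_def hecke_prod_def scaled_term_def using f
      by (intro V_sum V_mult V_prod V_hecke V_powi V_x V_scaled) (auto simp: Sym_def)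
    moreover have "permute p (subset_sum (scaled_term n f) {1..N} \<alpha> {}) =
        subset_sum (scaled_term n f) {1..N} \<alpha> {}" if p: "p permutes {1..N}" for p
      using p f by (subst permute_subset_sum)
        (auto simp: permutes_bij permutes_image permute_scaled_term Sym_permute)
    ultimately show "rho_D N \<alpha> n f \<in> Sym N"
      using assms f by (simp add: rho_D_eq Sym_def permute_def)
  qed
next
  fix f assume f: "f \<in> Sym N"
  have fin: "finite I" if "I \<subseteq> {1..N}" for I
    using that finite_subset by blast
  show *: "rho_D N \<alpha> n f = (\<Sum>I | I \<subseteq> {1..N} \<and> card I = \<alpha>. (\<Prod>i\<in>I. x i) powi n *
      (\<Prod>i\<in>I. \<Prod>j\<in>{1..N} - I. (theta * x i - inverse theta * x j) / (x i - x j)) * Gamma_set I f)"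
    unfolding rho_D_eq[OF assms(1) f] subset_sum_def
    by (intro sum.cong refl)
       (auto simp: Gamma_set_eq fin scaled_term_def hecke_prod_def hecke_coeff_def mult_ac)
  show "rho_D N \<alpha> n f = theta powi (- int (\<alpha> * (N - \<alpha>))) * gen_Macdonald N \<alpha> n f"
    unfolding * gen_Macdonald_def sum_distrib_left
  proof (intro sum.cong refl)
    fix I assume "I \<in> {I. I \<subseteq> {1..N} \<and> card I = \<alpha>}"
    then have I: "I \<subseteq> {1..N}" "card I = \<alpha>"
      by auto
    \<comment> \<open>Each pair of \<open>i\<close> in \<open>I\<close> and \<open>j\<close> outside
      \<open>I\<close> contributes one factor \<open>theta\<close>, and there are \<alpha>(N -
      \<alpha>) such pairs.\<close>
    have t: "(t * x i - x j) / (x i - x j) = theta * ((theta * x i - inverse theta * x j) / (x i - x j))" for i j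
      by (simp add: t_def power2_eq_square algebra_simps)
    have "card ({1..N} - I) = N - \<alpha>"
      using I by (simp add: card_Diff_subset fin)
    then have "(\<Prod>i\<in>I. \<Prod>j\<in>{1..N} - I. (t * x i - x j) / (x i - x j)) = theta ^ (\<alpha> * (N - \<alpha>)) *
        (\<Prod>i\<in>I. \<Prod>j\<in>{1..N} - I. (theta * x i - inverse theta * x j) / (x i - x j))"
      unfolding t prod.distrib by (simp add: I power_mult mult.commute[of \<alpha>])
    moreover have "(\<Prod>i\<in>I. x i powi n) = (\<Prod>i\<in>I. x i) powi n"
      by (induction I rule: infinite_finite_induct) (simp_all add: power_int_mult_distrib)
    moreover have "theta powi (- int (\<alpha> * (N - \<alpha>))) * theta ^ (\<alpha> * (N - \<alpha>)) = 1"
      by (simp add: power_int_minus power_int_of_nat del: of_nat_mult)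
    ultimately show "(\<Prod>i\<in>I. x i) powi n *
        (\<Prod>i\<in>I. \<Prod>j\<in>{1..N} - I. (theta * x i - inverse theta * x j) / (x i - x j)) * Gamma_set I f =
        theta powi (- int (\<alpha> * (N - \<alpha>))) * ((\<Prod>i\<in>I. x i powi n) *
        (\<Prod>i\<in>I. \<Prod>j\<in>{1..N} - I. (t * x i - x j) / (x i - x j)) * Gamma_set I f)"
      by simp
  qed
qed

end
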